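(* Let $S$ be a finite set with $q:=|S|\ge2$, let $X=S^{\mathbb{N}}$ with shift map $T$, and let $f:X\to\mathbb{R}$ depend only on the first two coordinates, $f(x)=f(x_0,x_1)$. Let $w=(w_k)_{k\ge 0}$ be a sequence taking values in a finite set $\{v_0,v_1,\dots,v_{m-1}\}\subset\mathbb{R}$, and suppose that $(w_k)$ is generic for some shift-invariant ergodic probability measure on $\{v_0,\dots,v_{m-1}\}^{\mathbb{N}}$. Let $\psi(\beta)$ ($\beta\in\mathbb{R}$) be the associated pressure function $$\psi(\beta)=\lim_{n\to\infty}\frac1n\log\|A_{w_1}(\beta)A_{w_2}(\beta)\cdots A_{w_n}(\beta)\|.$$ If $\alpha=\psi'(\beta)$ for some $\beta\in\mathbb{R}$, then $$\dim E(\alpha)=\operatorname{Dim}E(\alpha)=\frac{\psi(\beta)-\alpha\beta}{\log q},$$ where $$E(\alpha)=\Big\{x\in X:\lim_{n\to\infty}\frac1n\sum_{k=0}^{n-1}w_kf(T^kx)=\alpha\Big\}.$$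
   Context: For $\beta\in\mathbb{R}$ and $j\in\{0,\dots,m-1\}$, $A_j(\beta)$ is the $q\times q$ positive matrix $A_j(\beta)=(e^{\beta v_jf(a,b)})_{(a,b)\in S\times S}$, and $A_{w_k}(\beta)$ means $A_j(\beta)$ when $w_k=v_j$. Under the genericity assumption the limit defining $\psi(\beta)$ exists for every $\beta\in\mathbb{R}$ and $\psi$ is an analytic function of $\beta$. $\|\cdot\|$ is any matrix norm. $\dim$ and $\operatorname{Dim}$ denote respectively Hausdorff and packing dimension in $X$ with respect to the usual metric $d(x,y)=q^{-\min\{k:x_k\neq y_k\}}$. The sequence $w$ is generic for a shift-invariant measure $\nu$ if $\frac1n\sum_{k=0}^{n-1}\delta_{\sigma^kw}\to\nu$ weak-*, $\sigma$ being the shift on $\{v_0,\dots,v_{m-1}\}^{\mathbb{N}}$. *)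

theory Defs
  imports "HOL-Probability.Probability"
begin

section \<open>Hausdorff and packing dimension of subsets of a metric space\<close>

context Metric_space
begin

definition ediam :: "'a set \<Rightarrow> ennreal" where
  "ediam U = (SUP p\<in>U \<times> U. ennreal (d (fst p) (snd p)))"

text \<open>The term contributed to Hausdorff sums by a set of finite diameter, with the conventions
  that the empty set contributes nothing and that a nonempty set contributes 1 when the exponent
  is 0 (whereas \<open>0 powr 0 = 0\<close> in the library).\<close>

definition diam_powr :: "real \<Rightarrow> 'a set \<Rightarrow> ennreal" where
  "diam_powr s U =
     (if U = {} then 0 else if s = 0 then 1 else ennreal (enn2real (ediam U) powr s))"

definition hausdorff_content :: "real \<Rightarrow> real \<Rightarrow> 'a set \<Rightarrow> ennreal" where
  "hausdorff_content \<delta> s E =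
     (INF U\<in>{U :: nat \<Rightarrow> 'a set. E \<subseteq> (\<Union>i. U i) \<and> (\<forall>i. U i \<subseteq> M \<and> ediam (U i) \<le> ennreal \<delta>)}.
        (\<Sum>i. diam_powr s (U i)))"

definition hausdorff_measure :: "real \<Rightarrow> 'a set \<Rightarrow> ennreal" where
  "hausdorff_measure s E = (SUP \<delta>\<in>{0<..}. hausdorff_content \<delta> s E)"

definition hausdorff_dim :: "'a set \<Rightarrow> ereal" where
  "hausdorff_dim E = Inf (ereal ` {s. 0 \<le> s \<and> hausdorff_measure s E = 0})"

text \<open>A \<open>\<delta>\<close>-packing of \<open>E\<close> is a countable family of pairwise disjoint closed balls of radius
  at most \<open>\<delta>\<close> centred in \<open>E\<close>, given by its set of pairs (centre, radius).\<close>

definition packings :: "real \<Rightarrow> 'a set \<Rightarrow> ('a \<times> real) set set" where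
  "packings \<delta> E =
     {B. countable B \<and> (\<forall>(x, r)\<in>B. x \<in> E \<and> 0 < r \<and> r \<le> \<delta>) \<and>
         pairwise (\<lambda>p p'. disjnt (mcball (fst p) (snd p)) (mcball (fst p') (snd p'))) B}"

definition packing_premeasure :: "real \<Rightarrow> 'a set \<Rightarrow> ennreal" where
  "packing_premeasure s E =
     (INF \<delta>\<in>{0<..}. SUP B\<in>packings \<delta> E. (\<Sum>\<^sub>\<infinity>(x, r)\<in>B. ennreal ((2 * r) powr s)))"

definition packing_measure :: "real \<Rightarrow> 'a set \<Rightarrow> ennreal" where
  "packing_measure s E =
     (INF F\<in>{F :: nat \<Rightarrow> 'a set. E \<subseteq> (\<Union>i. F i) \<and> (\<forall>i. F i \<subseteq> M)}.
        (\<Sum>i. packing_premeasure s (F i)))"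

definition packing_dim :: "'a set \<Rightarrow> ereal" where
  "packing_dim E = Inf (ereal ` {s. 0 \<le> s \<and> packing_measure s E = 0})"

end


section \<open>One-sided sequence spaces\<close>

definition seq_shift :: "(nat \<Rightarrow> 'a) \<Rightarrow> nat \<Rightarrow> 'a" where
  "seq_shift x = (\<lambda>k. x (Suc k))"

definition seq_dist :: "(nat \<Rightarrow> 's::finite) \<Rightarrow> (nat \<Rightarrow> 's) \<Rightarrow> real" where
  "seq_dist x y =
     (if x = y then 0 else (1 / real CARD('s)) ^ (LEAST k. x k \<noteq> y k))"

lemma Metric_space_seq_dist: "Metric_space UNIV (seq_dist :: (nat \<Rightarrow> 's::finite) \<Rightarrow> _)"
proof
  fix x y z :: "nat \<Rightarrow> 's"
  have q: "0 < 1 / real CARD('s)" "1 / real CARD('s) \<le> 1"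
    by (auto simp: Suc_le_eq zero_less_card_finite)
  show "0 \<le> seq_dist x y"
    by (simp add: seq_dist_def)
  show "seq_dist x y = seq_dist y x"
    by (simp add: seq_dist_def eq_commute)
  show "seq_dist x y = 0 \<longleftrightarrow> x = y"
    by (simp add: seq_dist_def)
  show "seq_dist x z \<le> seq_dist x y + seq_dist y z"
  proof (cases "x = y \<or> y = z \<or> x = z")
    case True
    then show ?thesis by (auto simp: seq_dist_def)
  next
    case False
    define k where "k = (LEAST k. x k \<noteq> z k)"
    have "\<exists>k. x k \<noteq> z k" using False by auto
    then have "x k \<noteq> z k" unfolding k_def by (rule LeastI_ex)
    then have "x k \<noteq> y k \<or> y k \<noteq> z k" by auto
    then have "(LEAST k. x k \<noteq> y k) \<le> k \<or> (LEAST k. y k \<noteq> z k) \<le> k"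
      by (auto intro: Least_le)
    then have "seq_dist x z \<le> seq_dist x y \<or> seq_dist x z \<le> seq_dist y z"
      using False q by (auto simp: seq_dist_def k_def[symmetric] intro!: power_decreasing)
    moreover have "0 \<le> seq_dist x y" "0 \<le> seq_dist y z"
      by (simp_all add: seq_dist_def)
    ultimately show ?thesis by linarith
  qed
qed


section \<open>Generic sequences\<close>

abbreviation seqs_in :: "'a set \<Rightarrow> (nat \<Rightarrow> 'a) set" where
  "seqs_in V \<equiv> UNIV \<rightarrow> V"

definition borel_prob_on_seqs :: "real set \<Rightarrow> (nat \<Rightarrow> real) measure \<Rightarrow> bool" where
  "borel_prob_on_seqs V \<nu> \<longleftrightarrow>
     prob_space \<nu> \<and> sets \<nu> = sets (restrict_space borel (seqs_in V))"

definition shift_invariant :: "(nat \<Rightarrow> real) measure \<Rightarrow> bool" where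
  "shift_invariant \<nu> \<longleftrightarrow>
     (\<forall>A\<in>sets \<nu>. emeasure \<nu> (seq_shift -` A \<inter> space \<nu>) = emeasure \<nu> A)"

definition shift_ergodic :: "(nat \<Rightarrow> real) measure \<Rightarrow> bool" where
  "shift_ergodic \<nu> \<longleftrightarrow>
     (\<forall>A\<in>sets \<nu>. seq_shift -` A \<inter> space \<nu> = A \<longrightarrow> measure \<nu> A = 0 \<or> measure \<nu> A = 1)"

text \<open>The left-hand side below is the integral of \<open>\<phi>\<close> against the empirical measure
  \<open>(1/n) \<Sum>k<n. \<delta>\<close> at the point \<open>\<sigma>\<^sup>k w\<close>. For finite \<open>V\<close> the sequence space is compact, so
  testing against all continuous functions is weak-* convergence.\<close>

definition generic_for :: "real set \<Rightarrow> (nat \<Rightarrow> real) measure \<Rightarrow> (nat \<Rightarrow> real) \<Rightarrow> bool" where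
  "generic_for V \<nu> w \<longleftrightarrow>
     (\<forall>\<phi> :: (nat \<Rightarrow> real) \<Rightarrow> real. continuous_on (seqs_in V) \<phi> \<longrightarrow>
        (\<lambda>n. (\<Sum>k<n. \<phi> ((seq_shift ^^ k) w)) / real n) \<longlonglongrightarrow> (\<integral>x. \<phi> x \<partial>\<nu>))"


section \<open>Pressure function and level sets\<close>

definition matrix_norm :: "(real ^ 's ^ 's \<Rightarrow> real) \<Rightarrow> bool" where
  "matrix_norm N \<longleftrightarrow>
     (\<forall>A. 0 \<le> N A) \<and> (\<forall>A. N A = 0 \<longleftrightarrow> A = 0) \<and>
     (\<forall>c A. N (c *\<^sub>R A) = \<bar>c\<bar> * N A) \<and> (\<forall>A B. N (A + B) \<le> N A + N B)"

definition transfer_matrix :: "('s \<Rightarrow> 's \<Rightarrow> real) \<Rightarrow> real \<Rightarrow> real \<Rightarrow> real ^ 's ^ 's" where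
  "transfer_matrix g v \<beta> = (\<chi> a b. exp (\<beta> * v * g a b))"

text \<open>The product runs over the indices \<open>1, \<dots>, n\<close>; \<open>w 0\<close> does not occur.\<close>

primrec matrix_product ::
    "('s::finite \<Rightarrow> 's \<Rightarrow> real) \<Rightarrow> (nat \<Rightarrow> real) \<Rightarrow> real \<Rightarrow> nat \<Rightarrow> real ^ 's ^ 's" where
  "matrix_product g w \<beta> 0 = mat 1"
| "matrix_product g w \<beta> (Suc n) =
     matrix_product g w \<beta> n ** transfer_matrix g (w (Suc n)) \<beta>"

definition pressure ::
    "(real ^ 's ^ 's \<Rightarrow> real) \<Rightarrow> ('s::finite \<Rightarrow> 's \<Rightarrow> real) \<Rightarrow> (nat \<Rightarrow> real) \<Rightarrow> real \<Rightarrow> real" where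
  "pressure N g w \<beta> = lim (\<lambda>n. ln (N (matrix_product g w \<beta> n)) / real n)"

definition level_set ::
    "((nat \<Rightarrow> 's) \<Rightarrow> real) \<Rightarrow> (nat \<Rightarrow> real) \<Rightarrow> real \<Rightarrow> (nat \<Rightarrow> 's) set" where
  "level_set f w \<alpha> =
     {x. (\<lambda>n. (\<Sum>k<n. w k * f ((seq_shift ^^ k) x)) / real n) \<longlonglongrightarrow> \<alpha>}"

end

theory Submission
  imports Defs
begin

text \<open>
  Write \<open>S n x\<close> for the weighted sum over the first \<open>n\<close> edges of \<open>x\<close> (\<open>energy\<close>) and \<open>Z b n\<close>
  for the sum of \<open>exp (b * S n x)\<close> over words of length \<open>n + 1\<close> (\<open>partition_sum\<close>). Up to bounded
  factors \<open>Z b n\<close> is the norm of the matrix product, and its exponential growth rate is the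
  pressure \<open>\<psi> b\<close>. The rate exists as a limit because \<open>Z\<close> is multiplicative up to a constant factor,
  which turns \<open>ln (Z b n)\<close> into a Birkhoff sum along the generic sequence with an error per
  step that can be made small (\<open>convergent_ln_partition_sum\<close>).

  A word along which \<open>S n x\<close> is close to \<open>n * \<alpha>\<close> carries the weight \<open>exp (n * \<alpha> * \<beta>)\<close> out of the total
  \<open>exp (n * \<psi> \<beta>)\<close>, up to subexponential factors. So there are at most about
  \<open>exp (n * (\<psi> \<beta> - \<alpha> * \<beta>))\<close> such words, which bounds the packing dimension from above
  (\<open>nondeviating_words_count\<close>, \<open>packing_premeasure_zero\<close>).

  For the lower bound on the Hausdorff dimension, the Gibbs measure at \<open>\<beta>\<close> gives a cylinder
  around such a word mass about \<open>exp (- n * (\<psi> \<beta> - \<alpha> * \<beta>))\<close>, so by the mass distribution principle it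
  is enough that the measure charges the level set. This is where \<open>\<alpha> = \<psi>' \<beta>\<close> enters: comparing
  \<open>Z (\<beta> + t)\<close> and \<open>Z (\<beta> - t)\<close> with \<open>Z \<beta>\<close> shows that the probability of a deviation of \<open>S n x / n\<close> from
  \<open>\<alpha>\<close> decays exponentially (\<open>one_sided_deviation\<close>), hence is summable. The argument
  stays in finite volumes: a single sequence of times from which on the mean energy must be
  close to \<open>\<alpha>\<close> gives the good words probability at least \<open>1 / 2\<close> in every volume
  (\<open>uniformly_good_words\<close>), and Koenig's lemma reduces an arbitrary cover to a single finite volume
  (\<open>cylinder_cover_bound\<close>).

  The Hausdorff dimension never exceeds the packing dimension
  (\<open>hausdorff_dim_le_packing_dim\<close>), which closes the chain of inequalities.
\<close>

section \<open>Words, partition sums and finite Gibbs measures\<close>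

text \<open>Words are extensional functions on an initial segment, so that the cylinder of a point \<open>x\<close> is
  named by \<open>restrict x {..<n}\<close> and a word can itself be fed to functions of sequences.\<close>

abbreviation words :: "nat \<Rightarrow> (nat \<Rightarrow> 's::finite) set" where
  "words n \<equiv> {..<n} \<rightarrow>\<^sub>E UNIV"

definition append_word :: "nat \<Rightarrow> (nat \<Rightarrow> 's) \<Rightarrow> (nat \<Rightarrow> 's) \<Rightarrow> nat \<Rightarrow> 's" where
  "append_word n x y = (\<lambda>k. if k < n then x k else y (k - n))"

definition cylinder :: "nat \<Rightarrow> (nat \<Rightarrow> 's) \<Rightarrow> (nat \<Rightarrow> 's) set" where
  "cylinder n x = {y. \<forall>k<n. y k = x k}"

text \<open>The coefficient sequence is a parameter, so that the temperature enters by rescaling it and a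
  shift of the weights is just another coefficient sequence.\<close>

definition energy :: "('s \<Rightarrow> 's \<Rightarrow> real) \<Rightarrow> (nat \<Rightarrow> real) \<Rightarrow> nat \<Rightarrow> (nat \<Rightarrow> 's) \<Rightarrow> real" where
  "energy g u n x = (\<Sum>k<n. u k * g (x k) (x (Suc k)))"

definition partition_sum :: "('s::finite \<Rightarrow> 's \<Rightarrow> real) \<Rightarrow> (nat \<Rightarrow> real) \<Rightarrow> nat \<Rightarrow> real" where
  "partition_sum g u n = (\<Sum>x\<in>words (Suc n). exp (energy g u n x))"

lemma finite_words [simp]: "finite (words n :: (nat \<Rightarrow> 's::finite) set)"
  by (rule finite_PiE) auto

lemma words_nonempty: "(words n :: (nat \<Rightarrow> 's::finite) set) \<noteq> {}"
  by (simp add: PiE_eq_empty_iff)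

lemma restrict_in_words [simp]: "restrict x {..<n} \<in> words n"
  by auto

lemma sum_words_append:
  fixes h :: "(nat \<Rightarrow> 's::finite) \<Rightarrow> real"
  shows "(\<Sum>z\<in>words (n + m). h z) = (\<Sum>x\<in>words n. \<Sum>y\<in>words m. h (append_word n x y))"
proof -
  have "(\<Sum>x\<in>words n. \<Sum>y\<in>words m. h (append_word n x y))
      = (\<Sum>p\<in>words n \<times> words m. h (append_word n (fst p) (snd p)))"
    by (simp add: sum.cartesian_product case_prod_beta)
  also have "\<dots> = (\<Sum>z\<in>words (n + m). h z)"
  proof (rule sum.reindex_bij_witness[where
        j = "\<lambda>p. append_word n (fst p) (snd p)" and
        i = "\<lambda>z. (restrict z {..<n}, restrict (\<lambda>k. z (n + k)) {..<m})"])
    fix p :: "(nat \<Rightarrow> 's) \<times> (nat \<Rightarrow> 's)"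
    assume p: "p \<in> words n \<times> words m"
    then show "(restrict (append_word n (fst p) (snd p)) {..<n},
        restrict (\<lambda>k. append_word n (fst p) (snd p) (n + k)) {..<m}) = p"
      by (auto simp: append_word_def PiE_iff extensional_def fun_eq_iff prod_eq_iff)
    show "append_word n (fst p) (snd p) \<in> words (n + m)"
      using p by (auto simp: append_word_def PiE_iff extensional_def)
  next
    fix z :: "nat \<Rightarrow> 's"
    assume "z \<in> words (n + m)"
    then show "append_word n (fst (restrict z {..<n}, restrict (\<lambda>k. z (n + k)) {..<m}))
        (snd (restrict z {..<n}, restrict (\<lambda>k. z (n + k)) {..<m})) = z"
      by (auto simp: append_word_def PiE_iff extensional_def fun_eq_iff)
    show "(restrict z {..<n}, restrict (\<lambda>k. z (n + k)) {..<m}) \<in> words n \<times> words m"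
      by auto
  qed auto
  finally show ?thesis ..
qed

lemma energy_cong:
  "(\<And>k. k < Suc n \<Longrightarrow> x k = y k) \<Longrightarrow> energy g u n x = energy g u n y"
  unfolding energy_def by (intro sum.cong) auto

lemma energy_scale: "energy g (\<lambda>k. c * u k) n x = c * energy g u n x"
  by (simp add: energy_def sum_distrib_left mult.assoc)

lemma energy_append:
  "energy g u (Suc n + m) (append_word (Suc n) x y)
     = energy g u n x + u n * g (x n) (y 0) + energy g (\<lambda>k. u (Suc n + k)) m y"
proof -
  have "energy g u (Suc n + m) z = energy g u n z + u n * g (z n) (z (Suc n))
      + energy g (\<lambda>k. u (Suc n + k)) m (\<lambda>k. z (Suc n + k))" for z
    unfolding energy_def by (induction m) simp_all
  moreover have "energy g u n (append_word (Suc n) x y) = energy g u n x"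
    by (rule energy_cong) (simp add: append_word_def)
  moreover have "energy g v m (\<lambda>k. append_word (Suc n) x y (Suc n + k)) = energy g v m y" for v
    by (rule energy_cong) (simp add: append_word_def)
  ultimately show ?thesis
    by (simp add: append_word_def)
qed

lemma partition_sum_pos: "0 < partition_sum g u n"
  unfolding partition_sum_def
  by (rule sum_pos) (use words_nonempty in auto)

text \<open>A word of \<open>n + m + 2\<close> letters is a word of \<open>n + 1\<close> letters, one free edge, and a word of
  \<open>m + 1\<close> letters. Since the free edge contributes a factor between \<open>exp (- B)\<close> and \<open>exp B\<close>,
  partition sums are multiplicative up to a constant that depends on neither length.\<close>

lemma partition_sum_append:
  fixes g :: "'s::finite \<Rightarrow> 's \<Rightarrow> real"
  assumes B: "\<And>k a b. \<bar>u k * g a b\<bar> \<le> B"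
  shows "partition_sum g u (Suc n + m)
          \<le> exp B * (partition_sum g u n * partition_sum g (\<lambda>k. u (Suc n + k)) m)" (is ?upper)
    and "exp (- B) * (partition_sum g u n * partition_sum g (\<lambda>k. u (Suc n + k)) m)
          \<le> partition_sum g u (Suc n + m)" (is ?lower)
proof -
  let ?v = "\<lambda>k. u (Suc n + k)"
  have split: "partition_sum g u (Suc n + m) =
      (\<Sum>x\<in>words (Suc n). \<Sum>y\<in>words (Suc m).
         exp (u n * g (x n) (y 0)) * (exp (energy g u n x) * exp (energy g ?v m y)))"
    using sum_words_append[of "\<lambda>z. exp (energy g u (Suc n + m) z)" "Suc n" "Suc m"]
    unfolding partition_sum_def energy_append
    by (simp add: exp_add mult_ac)
  have prod: "c * (partition_sum g u n * partition_sum g ?v m) =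
      (\<Sum>x\<in>words (Suc n). \<Sum>y\<in>words (Suc m).
         c * (exp (energy g u n x) * exp (energy g ?v m y)))" for c
    unfolding partition_sum_def
    by (subst sum_product) (simp only: sum_distrib_left)
  have "exp (u n * g a b) \<le> exp B" "exp (- B) \<le> exp (u n * g a b)" for a b
    using B[of n a b] by simp_all
  then show ?upper ?lower
    unfolding split prod by (auto intro!: sum_mono mult_right_mono)
qed

lemma ln_partition_sum_append:
  fixes g :: "'s::finite \<Rightarrow> 's \<Rightarrow> real"
  assumes B: "\<And>k a b. \<bar>u k * g a b\<bar> \<le> B"
  shows "\<bar>ln (partition_sum g u (Suc n + m))
      - (ln (partition_sum g u n) + ln (partition_sum g (\<lambda>k. u (Suc n + k)) m))\<bar> \<le> B"
proof -
  let ?a = "partition_sum g u n" and ?b = "partition_sum g (\<lambda>k. u (Suc n + k)) m"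
  have pos: "0 < ?a" "0 < ?b" "0 < partition_sum g u (Suc n + m)"
    by (rule partition_sum_pos)+
  have *: "ln (exp c * (?a * ?b)) = c + (ln ?a + ln ?b)" for c
    using pos by (simp add: ln_mult)
  have "ln (partition_sum g u (Suc n + m)) \<le> ln (exp B * (?a * ?b))"
    using partition_sum_append(1)[where u = u and g = g and B = B and n = n and m = m, OF B] pos by (simp add: ln_mono)
  moreover have "ln (exp (- B) * (?a * ?b)) \<le> ln (partition_sum g u (Suc n + m))"
    using partition_sum_append(2)[where u = u and g = g and B = B and n = n and m = m, OF B] pos by (intro ln_mono) simp_all
  ultimately show ?thesis
    unfolding * by linarith
qed

lemma partition_sum_0: "partition_sum (g :: 's::finite \<Rightarrow> 's \<Rightarrow> real) u 0 = real CARD('s)"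
  by (simp add: partition_sum_def energy_def card_PiE)

text \<open>The finite-volume Gibbs measures. They are never passed to an infinite-volume limit: the next
  lemma compares all of them with the one on the shortest words that determine the event.\<close>

definition gibbs_prob ::
    "('s::finite \<Rightarrow> 's \<Rightarrow> real) \<Rightarrow> (nat \<Rightarrow> real) \<Rightarrow> nat \<Rightarrow> ((nat \<Rightarrow> 's) \<Rightarrow> bool) \<Rightarrow> real" where
  "gibbs_prob g u n P =
     (\<Sum>x\<in>words (Suc n). if P x then exp (energy g u n x) else 0) / partition_sum g u n"

lemma gibbs_prob_nonneg: "0 \<le> gibbs_prob g u n P"
  unfolding gibbs_prob_def
  by (intro divide_nonneg_nonneg sum_nonneg less_imp_le[OF partition_sum_pos]) auto

text \<open>Summing out the letters after position \<open>n\<close> costs one factor \<open>exp B\<close> for the edge that is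
  removed, and comparing the normalisations costs another.\<close>

lemma gibbs_prob_extend:
  fixes g :: "'s::finite \<Rightarrow> 's \<Rightarrow> real"
  assumes B: "\<And>k a b. \<bar>u k * g a b\<bar> \<le> B"
    and P: "\<And>x y. (\<And>k. k < Suc n \<Longrightarrow> x k = y k) \<Longrightarrow> P x \<longleftrightarrow> P y"
    and "n \<le> l"
  shows "gibbs_prob g u l P \<le> exp (2 * B) * gibbs_prob g u n P"
proof -
  define s where "s = (\<Sum>x\<in>words (Suc n). if P x then exp (energy g u n x) else 0)"
  have s: "0 \<le> s" unfolding s_def by (simp add: sum_nonneg)
  have B0: "0 \<le> B" using B[of 0 undefined undefined] by linarith
  consider "l = n" | m where "l = Suc n + m"
    using \<open>n \<le> l\<close> by (metis add_Suc le_eq_less_or_eq less_iff_Suc_add)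
  then show ?thesis
  proof cases
    case 1
    have "1 * gibbs_prob g u n P \<le> exp (2 * B) * gibbs_prob g u n P"
      using B0 by (intro mult_right_mono gibbs_prob_nonneg) simp_all
    then show ?thesis
      by (simp add: 1)
  next
    case 2
    let ?v = "\<lambda>k. u (Suc n + k)"
    have P': "P (append_word (Suc n) x y) \<longleftrightarrow> P x" for x y
      by (rule P) (simp add: append_word_def)
    have "(\<Sum>z\<in>words (Suc l). if P z then exp (energy g u l z) else 0)
        = (\<Sum>z\<in>words (Suc n + Suc m). if P z then exp (energy g u l z) else 0)"
      by (simp add: 2)
    also have "\<dots> = (\<Sum>x\<in>words (Suc n). \<Sum>y\<in>words (Suc m). if P x then
        exp (u n * g (x n) (y 0)) * (exp (energy g u n x) * exp (energy g ?v m y)) else 0)"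
      unfolding sum_words_append P' 2 energy_append
      by (intro sum.cong refl) (simp add: exp_add)
    also have "\<dots> \<le> (\<Sum>x\<in>words (Suc n). \<Sum>y\<in>words (Suc m). if P x then
        exp B * (exp (energy g u n x) * exp (energy g ?v m y)) else 0)"
      using B by (intro sum_mono) (auto intro!: mult_right_mono simp: abs_le_iff)
    also have "\<dots> = (\<Sum>x\<in>words (Suc n). (if P x then exp (energy g u n x) else 0)
        * (exp B * partition_sum g ?v m))"
      by (intro sum.cong refl) (simp add: partition_sum_def sum_distrib_left mult_ac)
    also have "\<dots> = exp B * s * partition_sum g ?v m"
      unfolding s_def by (subst sum_distrib_right[symmetric]) simp
    finally have num: "(\<Sum>z\<in>words (Suc l). if P z then exp (energy g u l z) else 0)
        \<le> exp B * s * partition_sum g ?v m" .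
    have "gibbs_prob g u l P \<le> (exp B * s * partition_sum g ?v m)
        / (exp (- B) * (partition_sum g u n * partition_sum g ?v m))"
      using num partition_sum_append(2)[where u = u and g = g and B = B and n = n and m = m, OF B] s
      unfolding gibbs_prob_def
      by (intro frac_le) (auto simp: 2 partition_sum_pos intro!: mult_nonneg_nonneg
          less_imp_le[OF partition_sum_pos])
    also have "\<dots> = exp (2 * B) * (s / partition_sum g u n)"
      using partition_sum_pos[of g ?v m] partition_sum_pos[of g u n]
      by (simp add: exp_minus field_simps flip: exp_add)
    finally show ?thesis
      by (simp add: gibbs_prob_def s_def)
  qed
qed

lemma gibbs_prob_mono:
  assumes "\<And>x. x \<in> words (Suc n) \<Longrightarrow> P x \<Longrightarrow> Q x"
  shows "gibbs_prob g u n P \<le> gibbs_prob g u n Q"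
  unfolding gibbs_prob_def
  by (intro divide_right_mono sum_mono less_imp_le[OF partition_sum_pos]) (use assms in auto)

lemma gibbs_prob_Ex_le:
  assumes "finite I"
  shows "gibbs_prob g u n (\<lambda>x. \<exists>i\<in>I. P i x) \<le> (\<Sum>i\<in>I. gibbs_prob g u n (P i))"
proof -
  have *: "(if \<exists>i\<in>I. P i x then exp (energy g u n x) else 0)
      \<le> (\<Sum>i\<in>I. if P i x then exp (energy g u n x) else 0)" for x
  proof (cases "\<exists>i\<in>I. P i x")
    case True
    then obtain j where "j \<in> I" "P j x" by blast
    then show ?thesis
      using member_le_sum[of j I "\<lambda>i. if P i x then exp (energy g u n x) else 0"] assms True by auto
  qed (auto intro: sum_nonneg)
  show ?thesis
    unfolding gibbs_prob_def sum_divide_distrib[symmetric]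
    by (subst sum.swap, intro divide_right_mono sum_mono *) (simp add: less_imp_le[OF partition_sum_pos])
qed

lemma gibbs_prob_not: "gibbs_prob g u n (\<lambda>x. \<not> P x) = 1 - gibbs_prob g u n P"
proof -
  have "gibbs_prob g u n (\<lambda>x. \<not> P x) + gibbs_prob g u n P = 1"
    using partition_sum_pos[of g u n] unfolding gibbs_prob_def add_divide_distrib[symmetric]
      sum.distrib[symmetric]
    by (simp add: partition_sum_def if_distrib cong: if_cong)
  then show ?thesis by simp
qed

lemma cylinder_weight_le:
  fixes g :: "'s::finite \<Rightarrow> 's \<Rightarrow> real"
  assumes B: "\<And>k a b. \<bar>u k * g a b\<bar> \<le> B" and "n \<le> l"
  shows "gibbs_prob g u l (\<lambda>z. z \<in> cylinder (Suc n) x)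
    \<le> exp (2 * B) * (exp (energy g u n x) / partition_sum g u n)"
proof -
  have "gibbs_prob g u l (\<lambda>z. z \<in> cylinder (Suc n) x)
      \<le> exp (2 * B) * gibbs_prob g u n (\<lambda>z. z \<in> cylinder (Suc n) x)"
    by (rule gibbs_prob_extend[where B = B, OF B _ \<open>n \<le> l\<close>]) (simp add: cylinder_def)
  also have "gibbs_prob g u n (\<lambda>z. z \<in> cylinder (Suc n) x) = exp (energy g u n x) / partition_sum g u n"
  proof -
    have iff: "z \<in> cylinder (Suc n) x \<longleftrightarrow> z = restrict x {..<Suc n}" if "z \<in> words (Suc n)" for z
      using that by (auto simp: cylinder_def PiE_iff extensional_def fun_eq_iff)
    have "(\<Sum>z\<in>words (Suc n). if z \<in> cylinder (Suc n) x then exp (energy g u n z) else 0)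
        = (\<Sum>z\<in>words (Suc n). if z = restrict x {..<Suc n} then exp (energy g u n z) else 0)"
      by (intro sum.cong refl) (simp add: iff)
    also have "\<dots> = exp (energy g u n (restrict x {..<Suc n}))"
      by (simp add: sum.delta)
    also have "energy g u n (restrict x {..<Suc n}) = energy g u n x"
      by (rule energy_cong) simp
    finally show ?thesis
      by (simp add: gibbs_prob_def)
  qed
  finally show ?thesis .
qed

section \<open>Convergence of the logarithmic growth rate\<close>

lemma seq_shift_funpow: "(seq_shift ^^ k) x = (\<lambda>i. x (k + i))"
  by (induction k) (auto simp: seq_shift_def fun_eq_iff)

lemma sum_translate:
  fixes a :: "nat \<Rightarrow> real"
  shows "(\<Sum>k<n. a (k + p)) = (\<Sum>k<n. a k) + (\<Sum>i<p. a (n + i)) - (\<Sum>i<p. a i)"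
proof (induction n)
  case (Suc n)
  have "(\<Sum>i<p. a (Suc n + i)) + a n = (\<Sum>i<p. a (n + i)) + a (n + p)"
    by (induction p) simp_all
  then show ?case
    using Suc by simp
qed simp

lemma abs_increment_le:
  fixes a :: "nat \<Rightarrow> real"
  assumes "\<And>n. \<bar>a (Suc n) - a n\<bar> \<le> c"
  shows "\<bar>a (n + i) - a n\<bar> \<le> real i * c"
proof (induction i)
  case (Suc i)
  then show ?case
    using assms[of "n + i"] by (simp add: algebra_simps abs_le_iff)
qed simp

text \<open>The approximating sequences may depend on \<open>p\<close>: the limits superior and inferior of \<open>x\<close>
  differ by at most \<open>2 * B / p\<close> for every \<open>p\<close>.\<close>

lemma convergent_of_approximations:
  fixes x :: "nat \<Rightarrow> real"
  assumes "\<And>p :: nat. p > 0 \<Longrightarrow> \<exists>y K. convergent y \<and> (\<forall>n>0. \<bar>x n - y n\<bar> \<le> B / real p + K / real n)"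
  shows "convergent x"
proof (rule Cauchy_convergent, rule metric_CauchyI)
  fix e :: real
  assume e: "e > 0"
  have "(\<lambda>p. B / real p) \<longlonglongrightarrow> 0"
    by (rule lim_const_over_n)
  then have "\<forall>\<^sub>F p in sequentially. B / real p < e / 8"
    by (rule order_tendstoD(2)) (use e in simp)
  then have "\<forall>\<^sub>F p in sequentially. B / real p < e / 8 \<and> p > 0"
    using eventually_gt_at_top[of 0] by eventually_elim simp
  then obtain p :: nat where p: "B / real p < e / 8" "p > 0"
    unfolding eventually_sequentially by (metis order_refl)
  from assms[OF p(2)] obtain y K where
    y: "convergent y" "\<And>n. n > 0 \<Longrightarrow> \<bar>x n - y n\<bar> \<le> B / real p + K / real n"
    by blast
  have "(\<lambda>n. K / real n) \<longlonglongrightarrow> 0"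
    by (rule lim_const_over_n)
  then have "\<forall>\<^sub>F n in sequentially. K / real n < e / 8"
    by (rule order_tendstoD(2)) (use e in simp)
  then obtain N1 where N1: "\<And>n. n \<ge> N1 \<Longrightarrow> K / real n < e / 8"
    by (auto simp: eventually_sequentially)
  from y(1) have "Cauchy y" by (rule convergent_Cauchy)
  then obtain N2 where N2: "\<And>m n. m \<ge> N2 \<Longrightarrow> n \<ge> N2 \<Longrightarrow> dist (y m) (y n) < e / 2"
    using metric_CauchyD[of y "e / 2"] e by auto
  show "\<exists>M. \<forall>m\<ge>M. \<forall>n\<ge>M. dist (x m) (x n) < e"
  proof (intro exI allI impI)
    fix m n
    assume mn: "Suc (max N1 N2) \<le> m" "Suc (max N1 N2) \<le> n"
    have "dist (y m) (y n) < e / 2" "K / real n < e / 8" "K / real m < e / 8"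
      using N2[of m n] N1[of n] N1[of m] mn by linarith+
    moreover have "\<bar>x m - y m\<bar> \<le> B / real p + K / real m" "\<bar>x n - y n\<bar> \<le> B / real p + K / real n"
      using mn by (auto intro!: y)
    ultimately show "dist (x m) (x n) < e"
      using p(1) unfolding dist_real_def by linarith
  qed
qed

lemma uniform_potential_bound:
  fixes g :: "'s::finite \<Rightarrow> 's \<Rightarrow> real" and w :: "nat \<Rightarrow> real"
  assumes "finite V" "\<And>k. w k \<in> V"
  shows "\<exists>B\<ge>0. \<forall>k a b. \<bar>\<beta> * w k * g a b\<bar> \<le> B"
proof -
  let ?F = "(\<lambda>(v, a, b). \<bar>\<beta> * v * g a b\<bar>) ` (V \<times> UNIV \<times> UNIV)"
  have fin: "finite ?F" using assms(1) by auto
  have le: "\<bar>\<beta> * w k * g a b\<bar> \<le> Max ?F" for k a b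
    by (rule Max_ge[OF fin], rule image_eqI[where x = "(w k, a, b)"], use assms(2)[of k] in simp_all)
  then have "0 \<le> Max ?F"
    by (rule order_trans[OF abs_ge_zero])
  with le show ?thesis by blast
qed

lemma continuous_on_ln_partition_sum:
  fixes g :: "'s::finite \<Rightarrow> 's \<Rightarrow> real"
  shows "continuous_on A (\<lambda>v. ln (partition_sum g (\<lambda>k. \<beta> * v (Suc k)) m))"
proof (rule continuous_on_ln)
  show "continuous_on A (\<lambda>v. partition_sum g (\<lambda>k. \<beta> * v (Suc k)) m)"
    unfolding partition_sum_def energy_def
    by (intro continuous_intros continuous_on_subset[OF continuous_on_product_coordinates]) auto
qed (simp add: partition_sum_pos less_imp_neq[symmetric])

text \<open>Let \<open>a n\<close> be the logarithm of the partition sum. Almost multiplicativity says that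
  \<open>a (n + p) - a n\<close> is, up to \<open>B\<close>, a function of the \<open>p - 1\<close> weights that follow
  position \<open>n\<close>. Summing over \<open>n\<close>, the left-hand sides telescope to \<open>p * a n\<close> up to a
  bounded error, and the right-hand sides are Birkhoff sums of a continuous function along the
  generic sequence. So \<open>a n / n\<close> differs from a convergent sequence by about \<open>B / p\<close>.\<close>

lemma convergent_ln_partition_sum:
  fixes g :: "'s::finite \<Rightarrow> 's \<Rightarrow> real"
  assumes V: "finite V" "\<And>k. w k \<in> V"
    and gen: "generic_for V \<nu> w"
  shows "convergent (\<lambda>n. ln (partition_sum g (\<lambda>k. \<beta> * w k) n) / real n)"
proof -
  obtain B where "0 \<le> B" and B': "\<forall>k a b. \<bar>\<beta> * w k * g a b\<bar> \<le> B"
    using uniform_potential_bound[of V w \<beta> g] V by auto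
  then have B: "\<bar>\<beta> * w k * g a b\<bar> \<le> B" for k a b
    by blast
  define a where "a n = ln (partition_sum g (\<lambda>k. \<beta> * w k) n)" for n
  define \<phi> where "\<phi> m v = ln (partition_sum g (\<lambda>k. \<beta> * v (Suc k)) m)" for m v
  have step: "\<bar>a (n + Suc m) - (a n + \<phi> m ((seq_shift ^^ n) w))\<bar> \<le> B" for n m
      using ln_partition_sum_append[where u = "\<lambda>k. \<beta> * w k" and g = g and B = B and n = n and m = m, OF B]
      by (simp only: a_def \<phi>_def seq_shift_funpow add_Suc add_Suc_right)
  define c where "c = B + \<bar>ln (real CARD('s))\<bar>"
  have incr: "\<bar>a (Suc n) - a n\<bar> \<le> c" for n
    using step[of n 0] unfolding c_def \<phi>_def partition_sum_0 add_Suc_right add_0_right by linarith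
  have "convergent (\<lambda>n. a n / real n)"
  proof (rule convergent_of_approximations)
    fix p :: nat
    assume "p > 0"
    then obtain m where m: "p = Suc m"
      by (cases p) auto
    define s where "s n = (\<Sum>k<n. \<phi> m ((seq_shift ^^ k) w))" for n
    \<comment> \<open>bounds the two boundary blocks that survive the telescoping\<close>
    define K where "K = (\<Sum>i<p. \<bar>a i\<bar> + real i * c)"
    have "continuous_on (seqs_in V) (\<phi> m)"
      unfolding \<phi>_def by (rule continuous_on_ln_partition_sum)
    then have "convergent (\<lambda>n. s n / real n)"
      using gen unfolding generic_for_def s_def by (auto intro: convergentI)
    then have conv: "convergent (\<lambda>n. s n / real n / real p)"
      using convergent_mult[OF _ convergent_const[of "1 / real p"], of "\<lambda>n. s n / real n"] by simp
    have main: "\<bar>real p * a n - s n\<bar> \<le> real n * B + K" for n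
    proof -
      have "\<bar>(\<Sum>k<n. a (k + p) - a k - \<phi> m ((seq_shift ^^ k) w))\<bar> \<le> (\<Sum>k<n. B)"
        by (rule order_trans[OF sum_abs], rule sum_mono)
          (use step[of _ m] in \<open>simp add: m algebra_simps\<close>)
      then have 1: "\<bar>(\<Sum>i<p. a (n + i)) - (\<Sum>i<p. a i) - s n\<bar> \<le> real n * B"
        by (simp add: sum_subtractf sum_translate s_def)
      have "\<bar>\<Sum>i<p. (a (n + i) - a n) - a i\<bar> \<le> K"
        unfolding K_def
      proof (rule order_trans[OF sum_abs], rule sum_mono)
        fix i
        show "\<bar>a (n + i) - a n - a i\<bar> \<le> \<bar>a i\<bar> + real i * c"
          using abs_increment_le[of a c n i, OF incr] by linarith
      qed
      then have "\<bar>(\<Sum>i<p. a (n + i)) - real p * a n - (\<Sum>i<p. a i)\<bar> \<le> K"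
        by (simp add: sum_subtractf)
      with 1 show ?thesis by linarith
    qed
    have "\<bar>a n / real n - s n / real n / real p\<bar> \<le> B / real p + K / real p / real n" if "n > 0" for n
    proof -
      have "a n / real n - s n / real n / real p = (real p * a n - s n) / (real p * real n)"
        using that \<open>p > 0\<close> by (simp add: field_simps)
      then have "\<bar>a n / real n - s n / real n / real p\<bar> = \<bar>real p * a n - s n\<bar> / (real p * real n)"
        by (simp add: abs_divide)
      also have "\<dots> \<le> (real n * B + K) / (real p * real n)"
        using main by (intro divide_right_mono) auto
      also have "\<dots> = B / real p + K / real p / real n"
        using that \<open>p > 0\<close> by (simp add: field_simps)
      finally show ?thesis .
    qed
    with conv show "\<exists>y K. convergent y \<and>
        (\<forall>n>0. \<bar>a n / real n - y n\<bar> \<le> B / real p + K / real n)"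
      by (intro exI[of _ "\<lambda>n. s n / real n / real p"] exI[of _ "K / real p"]) simp
  qed
  then show ?thesis by (simp add: a_def)
qed

section \<open>The pressure as a limit of partition sums\<close>

definition entry_sum :: "real ^ 's ^ 's \<Rightarrow> real" where
  "entry_sum A = (\<Sum>a\<in>UNIV. \<Sum>b\<in>UNIV. A $ a $ b)"

lemma sum_words_Suc:
  fixes h :: "(nat \<Rightarrow> 's::finite) \<Rightarrow> real"
  shows "(\<Sum>z\<in>words (Suc n). h z) = (\<Sum>x\<in>words n. \<Sum>b\<in>UNIV. h (append_word n x (\<lambda>k. if k = 0 then b else undefined)))"
proof -
  have *: "(\<lambda>k. if k = 0 then y 0 else undefined) = y" if "y \<in> words 1" for y :: "nat \<Rightarrow> 's"
    using that by (auto simp: PiE_iff extensional_def fun_eq_iff)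
  have "(\<Sum>y\<in>words 1. f y) = (\<Sum>b\<in>UNIV. f (\<lambda>k. if k = 0 then b else undefined))"
    for f :: "(nat \<Rightarrow> 's) \<Rightarrow> real"
    by (rule sum.reindex_bij_witness[where
        i = "\<lambda>b k. if k = 0 then b else undefined" and j = "\<lambda>y. y 0"])
      (simp_all add: *, auto simp: PiE_iff extensional_def)
  then show ?thesis
    using sum_words_append[of h n 1] by simp
qed

text \<open>The test function \<open>h\<close> of the last letter is what makes the induction on the right-hand factor
  of the matrix product go through.\<close>

lemma matrix_product_path_sum:
  fixes g :: "'s::finite \<Rightarrow> 's \<Rightarrow> real"
  shows "(\<Sum>b\<in>UNIV. (\<Sum>a\<in>UNIV. matrix_product g w \<beta> n $ a $ b) * h b)
    = (\<Sum>x\<in>words (Suc n). exp (energy g (\<lambda>k. \<beta> * w (Suc k)) n x) * h (x n))"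
proof (induction n arbitrary: h)
  case 0
  have "(\<Sum>x\<in>words (Suc 0). h (x 0)) = (\<Sum>b\<in>UNIV. h b)"
    by (subst sum_words_Suc) (simp add: append_word_def)
  then show ?case
    by (simp add: energy_def mat_def sum.delta)
next
  case (Suc n)
  let ?A = "transfer_matrix g (w (Suc n)) \<beta>"
  have "(\<Sum>b\<in>UNIV. (\<Sum>a\<in>UNIV. matrix_product g w \<beta> (Suc n) $ a $ b) * h b)
      = (\<Sum>b\<in>UNIV. \<Sum>a\<in>UNIV. \<Sum>c\<in>UNIV. matrix_product g w \<beta> n $ a $ c * ?A $ c $ b * h b)"
    by (simp add: matrix_matrix_mult_def sum_distrib_right)
  also have "\<dots> = (\<Sum>b\<in>UNIV. \<Sum>c\<in>UNIV. \<Sum>a\<in>UNIV. matrix_product g w \<beta> n $ a $ c * ?A $ c $ b * h b)"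
    by (intro sum.cong refl sum.swap)
  also have "\<dots> = (\<Sum>c\<in>UNIV. \<Sum>b\<in>UNIV. \<Sum>a\<in>UNIV. matrix_product g w \<beta> n $ a $ c * ?A $ c $ b * h b)"
    by (rule sum.swap)
  also have "\<dots> = (\<Sum>c\<in>UNIV. (\<Sum>a\<in>UNIV. matrix_product g w \<beta> n $ a $ c) * (\<Sum>b\<in>UNIV. ?A $ c $ b * h b))"
    by (subst sum_product, subst (2) sum.swap) (simp only: mult.assoc)
  also have "\<dots> = (\<Sum>x\<in>words (Suc n). exp (energy g (\<lambda>k. \<beta> * w (Suc k)) n x)
      * (\<Sum>b\<in>UNIV. ?A $ x n $ b * h b))"
    by (rule Suc.IH)
  also have "\<dots> = (\<Sum>x\<in>words (Suc (Suc n)). exp (energy g (\<lambda>k. \<beta> * w (Suc k)) (Suc n) x) * h (x (Suc n)))"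
  proof -
    have e: "energy g (\<lambda>k. \<beta> * w (Suc k)) (Suc n) (append_word (Suc n) x (\<lambda>k. if k = 0 then b else undefined))
        = energy g (\<lambda>k. \<beta> * w (Suc k)) n x + \<beta> * w (Suc n) * g (x n) b" for x b
      using energy_append[of g "\<lambda>k. \<beta> * w (Suc k)" n 0 x "\<lambda>k. if k = 0 then b else undefined"]
      by (simp add: energy_def)
    show ?thesis
      unfolding sum_words_Suc[of _ "Suc n"] e
      by (simp add: append_word_def transfer_matrix_def sum_distrib_left exp_add mult.assoc)
  qed
  finally show ?case .
qed

lemma entry_sum_matrix_product:
  fixes g :: "'s::finite \<Rightarrow> 's \<Rightarrow> real"
  shows "entry_sum (matrix_product g w \<beta> n) = partition_sum g (\<lambda>k. \<beta> * w (Suc k)) n"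
proof -
  have "entry_sum A = (\<Sum>b\<in>UNIV. (\<Sum>a\<in>UNIV. A $ a $ b) * 1)" for A :: "real ^ 's ^ 's"
    unfolding entry_sum_def by (subst sum.swap) simp
  then show ?thesis
    by (simp add: matrix_product_path_sum[where h = "\<lambda>_. 1", simplified] partition_sum_def)
qed

lemma matrix_product_nonneg: "0 \<le> matrix_product g w \<beta> n $ a $ b"
  by (induction n arbitrary: a b)
    (auto simp: mat_def matrix_matrix_mult_def transfer_matrix_def intro!: sum_nonneg)


text \<open>All norms are equivalent, and on matrices with nonnegative entries the entry sum is between two
  multiples of the Euclidean norm although it is not itself a norm. The lower bound is the
  minimum of \<open>N\<close> on the compact unit sphere.\<close>

lemma matrix_norm_equiv_entry_sum:
  fixes N :: "real ^ 's ^ 's \<Rightarrow> real"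
  assumes "matrix_norm N"
  shows "\<exists>c>0. \<exists>C>0. \<forall>A. (\<forall>a b. 0 \<le> A $ a $ b) \<longrightarrow> c * entry_sum A \<le> N A \<and> N A \<le> C * entry_sum A"
proof -
  have N0: "0 \<le> N A" and N0_iff: "N A = 0 \<longleftrightarrow> A = 0" and N_scale: "N (r *\<^sub>R A) = \<bar>r\<bar> * N A"
    and N_add: "N (A + A') \<le> N A + N A'" for A A' r
    using assms by (auto simp: matrix_norm_def)
  have N_sum: "N (\<Sum>i\<in>I. f i) \<le> (\<Sum>i\<in>I. N (f i))" if "finite I" for I and f :: "'b \<Rightarrow> real ^ 's ^ 's"
    using that
  proof induction
    case (insert i I)
    then show ?case using N_add[of "f i" "sum f I"] by simp
  next
    case empty
    then show ?case using N0_iff[of 0] by simp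
  qed
  define K where "K = (\<Sum>e\<in>(Basis :: (real ^ 's ^ 's) set). N e)"
  have K0: "0 \<le> K" by (simp add: K_def N0 sum_nonneg)
  have upper: "N A \<le> K * norm A" for A
  proof -
    have "N A = N (\<Sum>e\<in>Basis. (A \<bullet> e) *\<^sub>R e)"
      by (simp add: euclidean_representation)
    also have "\<dots> \<le> (\<Sum>e\<in>Basis. \<bar>A \<bullet> e\<bar> * N e)"
      using N_sum[of Basis "\<lambda>e. (A \<bullet> e) *\<^sub>R e"] by (simp add: N_scale)
    also have "\<dots> \<le> (\<Sum>e\<in>Basis. norm A * N e)"
      by (intro sum_mono mult_right_mono Basis_le_norm N0)
    finally show ?thesis
      by (simp add: K_def sum_distrib_left mult.commute)
  qed
  have "N A - N A' \<le> K * norm (A - A')" for A A'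
    using N_add[of "A - A'" A'] upper[of "A - A'"] by simp
  then have lip: "\<bar>N A - N A'\<bar> \<le> K * norm (A - A')" for A A'
    using norm_minus_commute[of A A'] by (simp add: abs_le_iff) (metis minus_diff_eq)
  have "continuous_on (sphere 0 1) N"
  proof (rule continuous_on_real_range[THEN iffD2], intro ballI allI impI)
    fix A :: "real ^ 's ^ 's" and e :: real
    assume "0 < e"
    have "\<bar>N A' - N A\<bar> < e" if "norm (A' - A) < e / (K + 1)" for A'
    proof -
      have "\<bar>N A' - N A\<bar> \<le> (K + 1) * norm (A' - A)"
        using lip[of A' A] norm_ge_zero[of "A' - A"] unfolding distrib_right by linarith
      also have "\<dots> < e"
        using that K0 by (simp add: field_simps)
      finally show ?thesis .
    qed
    then show "\<exists>d>0. \<forall>A'\<in>sphere 0 1. norm (A' - A) < d \<longrightarrow> \<bar>N A' - N A\<bar> < e"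
      using \<open>0 < e\<close> K0 by (intro exI[of _ "e / (K + 1)"]) simp
  qed
  moreover have "sphere 0 1 \<noteq> ({} :: (real ^ 's ^ 's) set)"
    by simp
  ultimately obtain S where S: "S \<in> sphere 0 1" "\<And>A. A \<in> sphere 0 1 \<Longrightarrow> N S \<le> N A"
    using continuous_attains_inf[of "sphere 0 1" N] by auto
  have "S \<noteq> 0" using S(1) by auto
  then have NS: "0 < N S"
    using N0[of S] N0_iff[of S] by linarith
  have lower: "N S * norm A \<le> N A" for A
  proof (cases "A = 0")
    case False
    have "N S \<le> N ((1 / norm A) *\<^sub>R A)"
      using False by (intro S(2)) simp
    with False show ?thesis by (simp add: N_scale field_simps)
  qed (simp add: N0)
  define q where "q = real CARD('s)"
  have q: "0 < q" by (simp add: q_def)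
  have entry: "A $ a $ b \<le> norm A" for A :: "real ^ 's ^ 's" and a b
    using component_le_norm_cart[of "A $ a" b]
      Finite_Cartesian_Product.norm_nth_le[of A a] by linarith
  have "entry_sum A \<le> (\<Sum>a\<in>(UNIV :: 's set). \<Sum>b\<in>(UNIV :: 's set). norm A)" for A :: "real ^ 's ^ 's"
    unfolding entry_sum_def by (intro sum_mono entry)
  then have e_le: "entry_sum A \<le> q * q * norm A" for A :: "real ^ 's ^ 's"
    by (simp add: q_def mult.assoc)
  have norm_le: "norm A \<le> entry_sum A" if "\<And>a b. 0 \<le> A $ a $ b" for A :: "real ^ 's ^ 's"
  proof -
    have "norm A \<le> (\<Sum>a\<in>UNIV. norm (A $ a))"
      by (simp add: norm_vec_def L2_set_le_sum)
    also have "\<dots> \<le> (\<Sum>a\<in>UNIV. \<Sum>b\<in>UNIV. norm (A $ a $ b))"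
      by (intro sum_mono) (simp add: norm_vec_def L2_set_le_sum)
    finally show ?thesis
      using that by (simp add: entry_sum_def)
  qed
  show ?thesis
  proof (intro exI conjI allI impI)
    fix A :: "real ^ 's ^ 's"
    assume A: "\<forall>a b. 0 \<le> A $ a $ b"
    have "N S / (q * q) * entry_sum A \<le> N S / (q * q) * (q * q * norm A)"
      using NS q by (intro mult_left_mono e_le) simp
    also have "\<dots> = N S * norm A"
      using q by simp
    also have "\<dots> \<le> N A" by (rule lower)
    finally show "N S / (q * q) * entry_sum A \<le> N A" .
    have "N A \<le> K * norm A" by (rule upper)
    also have "\<dots> \<le> (K + 1) * entry_sum A"
      using K0 norm_le[of A] A by (intro mult_mono) auto
    finally show "N A \<le> (K + 1) * entry_sum A" .
  qed (use NS q K0 in auto)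
qed

text \<open>The matrix product starts with the weight of index 1, so it yields the partition sum of the
  shifted weights; both the shift and the change of norm alter the logarithm by a bounded amount.\<close>

lemma ln_partition_sum_tendsto_pressure:
  fixes g :: "'s::finite \<Rightarrow> 's \<Rightarrow> real" and N :: "real ^ 's ^ 's \<Rightarrow> real"
  assumes V: "finite V" "\<And>k. w k \<in> V"
    and gen: "generic_for V \<nu> w" and N: "matrix_norm N"
  shows "(\<lambda>n. ln (partition_sum g (\<lambda>k. \<beta> * w k) n) / real n) \<longlonglongrightarrow> pressure N g w \<beta>"
proof -
  obtain B where "0 \<le> B" and B': "\<forall>k a b. \<bar>\<beta> * w k * g a b\<bar> \<le> B"
    using uniform_potential_bound[of V w \<beta> g] V by auto
  then have B: "\<bar>\<beta> * w k * g a b\<bar> \<le> B" for k a b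
    by blast
  define a where "a n = ln (partition_sum g (\<lambda>k. \<beta> * w k) n)" for n
  define M where "M = matrix_product g w \<beta>"
  obtain L where L: "(\<lambda>n. a n / real n) \<longlonglongrightarrow> L"
    using convergent_ln_partition_sum[OF V gen, of g \<beta>] by (auto simp: convergent_def a_def)
  obtain c C where cC: "0 < c" "0 < C"
    "\<And>A. (\<forall>a b. 0 \<le> A $ a $ b) \<Longrightarrow> c * entry_sum A \<le> N A \<and> N A \<le> C * entry_sum A"
    using matrix_norm_equiv_entry_sum[OF N] by blast
  define l where "l = \<bar>ln (real CARD('s))\<bar>"
  define K where "K = 2 * B + 2 * l + \<bar>ln c\<bar> + \<bar>ln C\<bar>"
  have close: "\<bar>ln (N (M n)) - a n\<bar> \<le> K" for n
  proof -
    define z where "z = partition_sum g (\<lambda>k. \<beta> * w (Suc k)) n"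
    have z: "0 < z" by (simp add: z_def partition_sum_pos)
    have bounds: "c * z \<le> N (M n)" "N (M n) \<le> C * z"
      using cC(3)[of "M n"] by (simp_all add: M_def matrix_product_nonneg entry_sum_matrix_product z_def)
    have "0 < c * z" using cC z by simp
    then have "ln (c * z) \<le> ln (N (M n))" "ln (N (M n)) \<le> ln (C * z)"
      using bounds by (auto intro!: ln_mono)
    then have "ln c + ln z \<le> ln (N (M n))" "ln (N (M n)) \<le> ln C + ln z"
      using cC z by (simp_all add: ln_mult)
    moreover have "\<bar>a (Suc n) - (ln (real CARD('s)) + ln z)\<bar> \<le> B"
      using ln_partition_sum_append[where u = "\<lambda>k. \<beta> * w k" and g = g and B = B and n = 0 and m = n, OF B]
      by (simp add: a_def z_def partition_sum_0)
    moreover have "\<bar>a (Suc n) - (a n + ln (real CARD('s)))\<bar> \<le> B"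
      using ln_partition_sum_append[where u = "\<lambda>k. \<beta> * w k" and g = g and B = B and n = n and m = 0, OF B]
      by (simp add: a_def partition_sum_0)
    ultimately show ?thesis
      unfolding K_def l_def by linarith
  qed
  have "(\<lambda>n. (ln (N (M n)) - a n) / real n) \<longlonglongrightarrow> 0"
  proof (rule tendsto_rabs_zero_cancel, rule tendsto_sandwich[where f = "\<lambda>_. 0"])
    show "(\<lambda>n. K / real n) \<longlonglongrightarrow> 0"
      by (rule lim_const_over_n)
    show "\<forall>\<^sub>F n in sequentially. \<bar>(ln (N (M n)) - a n) / real n\<bar> \<le> K / real n"
      using close by (intro always_eventually allI) (simp add: abs_divide divide_right_mono)
  qed auto
  from tendsto_add[OF this L] have "(\<lambda>n. ln (N (M n)) / real n) \<longlonglongrightarrow> L"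
    by (simp flip: add_divide_distrib)
  then have "pressure N g w \<beta> = L"
    by (simp add: pressure_def M_def limI)
  with L show ?thesis by (simp add: a_def)
qed

section \<open>Large deviations of the mean energy\<close>

text \<open>The sign \<open>\<sigma>\<close> selects the side of \<open>\<beta>\<close>; the two sides control the two tails of the mean energy.\<close>

lemma increment_less_linear:
  fixes \<psi> :: "real \<Rightarrow> real"
  assumes deriv: "(\<psi> has_real_derivative \<alpha>) (at \<beta>)" and e: "0 < \<epsilon>" and \<sigma>: "\<sigma> = 1 \<or> \<sigma> = -1"
  shows "\<exists>t>0. \<psi> (\<beta> + \<sigma> * t) - \<psi> \<beta> < t * (\<sigma> * \<alpha> + \<epsilon>)"
proof -
  have "((\<lambda>h. (\<psi> (\<beta> + h) - \<psi> \<beta>) / h) \<longlongrightarrow> \<alpha>) (at 0)"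
    using deriv by (simp add: DERIV_def)
  then have "\<forall>\<^sub>F h in at 0. dist ((\<psi> (\<beta> + h) - \<psi> \<beta>) / h) \<alpha> < \<epsilon>"
    using e by (rule tendstoD)
  then obtain d where d: "d > 0"
    "\<And>h. h \<noteq> 0 \<Longrightarrow> \<bar>h\<bar> < d \<Longrightarrow> \<bar>(\<psi> (\<beta> + h) - \<psi> \<beta>) / h - \<alpha>\<bar> < \<epsilon>"
    unfolding eventually_at by (auto simp: dist_real_def)
  define t where "t = d / 2"
  have t: "t > 0" using d(1) by (simp add: t_def)
  have "\<sigma> * t \<noteq> 0" "\<bar>\<sigma> * t\<bar> < d"
    using \<sigma> d(1) by (auto simp: t_def)
  then have "\<bar>(\<psi> (\<beta> + \<sigma> * t) - \<psi> \<beta>) / (\<sigma> * t) - \<alpha>\<bar> < \<epsilon>"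
    by (rule d(2))
  then have "\<psi> (\<beta> + \<sigma> * t) - \<psi> \<beta> < t * (\<sigma> * \<alpha> + \<epsilon>)"
    using \<sigma> t by (auto simp: abs_less_iff field_simps)
  with t show ?thesis by blast
qed

definition deviates ::
    "('s \<Rightarrow> 's \<Rightarrow> real) \<Rightarrow> (nat \<Rightarrow> real) \<Rightarrow> real \<Rightarrow> real \<Rightarrow> nat \<Rightarrow> (nat \<Rightarrow> 's) \<Rightarrow> bool" where
  "deviates g w \<alpha> \<epsilon> n x \<longleftrightarrow> \<bar>energy g w n x - real n * \<alpha>\<bar> > real n * \<epsilon>"

lemma deviates_cong:
  "(\<And>k. k < Suc n \<Longrightarrow> x k = y k) \<Longrightarrow> deviates g w \<alpha> \<epsilon> n x \<longleftrightarrow> deviates g w \<alpha> \<epsilon> n y"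
  unfolding deviates_def using energy_cong[of n x y g w] by simp

lemma nondeviating_of_limit:
  assumes "(\<lambda>n. energy g w n x / real n) \<longlonglongrightarrow> \<alpha>" "0 < \<epsilon>"
  shows "\<exists>m. \<forall>n\<ge>m. \<not> deviates g w \<alpha> \<epsilon> n x"
proof -
  obtain m where m: "\<And>n. m \<le> n \<Longrightarrow> \<bar>energy g w n x / real n - \<alpha>\<bar> < \<epsilon>"
    using metric_LIMSEQ_D[OF assms] by (auto simp: dist_real_def)
  have "\<not> deviates g w \<alpha> \<epsilon> n x" if "Suc m \<le> n" for n
  proof -
    have "energy g w n x - real n * \<alpha> = real n * (energy g w n x / real n - \<alpha>)"
      using that by (simp add: right_diff_distrib)
    then have "\<bar>energy g w n x - real n * \<alpha>\<bar> = real n * \<bar>energy g w n x / real n - \<alpha>\<bar>"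
      by (simp only: abs_mult abs_of_nat)
    also have "\<dots> \<le> real n * \<epsilon>"
      using m[of n] that by (intro mult_left_mono) auto
    finally show ?thesis by (simp add: deviates_def)
  qed
  then show ?thesis by blast
qed

lemma inverse_Suc_slack:
  fixes \<eta> b :: real
  assumes "0 < \<eta>"
  shows "\<exists>k. \<bar>b\<bar> * (1 / real (Suc k)) \<le> \<eta>"
proof -
  obtain k where "1 / real (Suc k) < \<eta> / (\<bar>b\<bar> + 1)"
    using reals_Archimedean[of "\<eta> / (\<bar>b\<bar> + 1)"] assms by (auto simp: inverse_eq_divide)
  then have "(\<bar>b\<bar> + 1) * (1 / real (Suc k)) \<le> \<eta>"
    by (simp add: pos_less_divide_eq mult.commute)
  moreover have "\<bar>b\<bar> * (1 / real (Suc k)) \<le> (\<bar>b\<bar> + 1) * (1 / real (Suc k))"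
    by (intro mult_right_mono) simp_all
  ultimately have "\<bar>b\<bar> * (1 / real (Suc k)) \<le> \<eta>"
    by linarith
  then show ?thesis ..
qed

lemma nondeviating_energy_bound:
  assumes "\<not> deviates g w \<alpha> \<epsilon> n x" and "\<bar>\<beta>\<bar> * \<epsilon> \<le> \<eta>"
  shows "\<bar>\<beta> * energy g w n x - real n * (\<alpha> * \<beta>)\<bar> \<le> real n * \<eta>"
proof -
  have "\<beta> * energy g w n x - real n * (\<alpha> * \<beta>) = \<beta> * (energy g w n x - real n * \<alpha>)"
    by (simp add: algebra_simps)
  then have "\<bar>\<beta> * energy g w n x - real n * (\<alpha> * \<beta>)\<bar> = \<bar>\<beta>\<bar> * \<bar>energy g w n x - real n * \<alpha>\<bar>"
    by (simp only: abs_mult)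
  also have "\<dots> \<le> \<bar>\<beta>\<bar> * (real n * \<epsilon>)"
    using assms(1) by (intro mult_left_mono) (simp_all add: deviates_def)
  also have "\<dots> = real n * (\<bar>\<beta>\<bar> * \<epsilon>)"
    by simp
  also have "\<dots> \<le> real n * \<eta>"
    by (intro mult_left_mono assms(2)) simp
  finally show ?thesis .
qed

context
  fixes g :: "'s::finite \<Rightarrow> 's \<Rightarrow> real" and w :: "nat \<Rightarrow> real" and \<psi> :: "real \<Rightarrow> real"
    and \<alpha> \<beta> :: real
  assumes pressure_limit:
      "\<And>b. (\<lambda>n. ln (partition_sum g (\<lambda>k. b * w k) n) / real n) \<longlonglongrightarrow> \<psi> b"
    and deriv: "(\<psi> has_real_derivative \<alpha>) (at \<beta>)"
begin

text \<open>The exponential Chebyshev inequality: on the deviation event the weight at \<open>\<beta>\<close> is at most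
  \<open>exp (- t * n * (\<sigma> * \<alpha> + \<epsilon>))\<close> times the weight at \<open>\<beta> + \<sigma> * t\<close>, so the probability is at most
  that factor times a quotient of partition sums, whose exponential rate is
  \<open>\<psi> (\<beta> + \<sigma> * t) - \<psi> \<beta>\<close>. Differentiability makes the total rate negative for small \<open>t\<close>.\<close>

lemma one_sided_deviation:
  assumes e: "0 < \<epsilon>" and \<sigma>: "\<sigma> = 1 \<or> \<sigma> = -1"
  shows "\<exists>c>0. \<forall>\<^sub>F n in sequentially.
    gibbs_prob g (\<lambda>k. \<beta> * w k) n (\<lambda>x. \<sigma> * (energy g w n x - real n * \<alpha>) > real n * \<epsilon>) \<le> exp (- (c * real n))"
proof -
  obtain t where t: "t > 0" "\<psi> (\<beta> + \<sigma> * t) - \<psi> \<beta> < t * (\<sigma> * \<alpha> + \<epsilon>)"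
    using increment_less_linear[OF deriv e \<sigma>] by blast
  define Z where "Z b n = partition_sum g (\<lambda>k. b * w k) n" for b n
  have Z: "0 < Z b n" for b n by (simp add: Z_def partition_sum_pos)
  define c where "c = (t * (\<sigma> * \<alpha> + \<epsilon>) - (\<psi> (\<beta> + \<sigma> * t) - \<psi> \<beta>)) / 2"
  have c: "c > 0" using t(2) by (simp add: c_def)
  have "(\<lambda>n. ln (Z (\<beta> + \<sigma> * t) n) / real n - ln (Z \<beta> n) / real n) \<longlonglongrightarrow> \<psi> (\<beta> + \<sigma> * t) - \<psi> \<beta>"
    unfolding Z_def by (intro tendsto_diff pressure_limit)
  moreover have "\<psi> (\<beta> + \<sigma> * t) - \<psi> \<beta> < t * (\<sigma> * \<alpha> + \<epsilon>) - c"
  proof -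
    have "2 * c = t * (\<sigma> * \<alpha> + \<epsilon>) - (\<psi> (\<beta> + \<sigma> * t) - \<psi> \<beta>)"
      by (simp add: c_def)
    with c show ?thesis by linarith
  qed
  ultimately have "\<forall>\<^sub>F n in sequentially.
      ln (Z (\<beta> + \<sigma> * t) n) / real n - ln (Z \<beta> n) / real n < t * (\<sigma> * \<alpha> + \<epsilon>) - c"
    by (rule order_tendstoD(2))
  then have "\<forall>\<^sub>F n in sequentially.
    gibbs_prob g (\<lambda>k. \<beta> * w k) n (\<lambda>x. \<sigma> * (energy g w n x - real n * \<alpha>) > real n * \<epsilon>) \<le> exp (- (c * real n))"
    using eventually_gt_at_top[of 0]
  proof eventually_elim
    case (elim n)
    let ?\<theta> = "t * (\<sigma> * \<alpha> + \<epsilon>) * real n"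
    have weight: "(if \<sigma> * (energy g w n x - real n * \<alpha>) > real n * \<epsilon> then exp (energy g (\<lambda>k. \<beta> * w k) n x) else 0)
        \<le> exp (energy g (\<lambda>k. (\<beta> + \<sigma> * t) * w k) n x) * exp (- ?\<theta>)" for x
    proof (cases "\<sigma> * (energy g w n x - real n * \<alpha>) > real n * \<epsilon>")
      case True
      then have "t * (real n * \<epsilon>) \<le> t * (\<sigma> * (energy g w n x - real n * \<alpha>))"
        using t(1) by (intro mult_left_mono) auto
      then have "\<beta> * energy g w n x \<le> (\<beta> + \<sigma> * t) * energy g w n x + - ?\<theta>"
        by (simp add: algebra_simps)
      then show ?thesis
        using True by (simp add: energy_scale flip: exp_add)
    qed simp
    have "gibbs_prob g (\<lambda>k. \<beta> * w k) n (\<lambda>x. \<sigma> * (energy g w n x - real n * \<alpha>) > real n * \<epsilon>)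
        \<le> Z (\<beta> + \<sigma> * t) n * exp (- ?\<theta>) / Z \<beta> n"
      unfolding gibbs_prob_def Z_def
      unfolding partition_sum_def[of g "\<lambda>k. (\<beta> + \<sigma> * t) * w k"] sum_distrib_right
      by (intro divide_right_mono sum_mono weight less_imp_le[OF partition_sum_pos])
    also have "\<dots> = exp (ln (Z (\<beta> + \<sigma> * t) n) - ln (Z \<beta> n) - ?\<theta>)"
      using Z by (simp add: exp_diff exp_minus divide_inverse)
    also have "\<dots> \<le> exp (- (c * real n))"
    proof -
      have "(ln (Z (\<beta> + \<sigma> * t) n) - ln (Z \<beta> n)) / real n < t * (\<sigma> * \<alpha> + \<epsilon>) - c"
        using elim by (simp add: diff_divide_distrib)
      then have "ln (Z (\<beta> + \<sigma> * t) n) - ln (Z \<beta> n) < (t * (\<sigma> * \<alpha> + \<epsilon>) - c) * real n"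
        using elim by (simp add: pos_divide_less_eq)
      then show ?thesis
        by (simp add: algebra_simps)
    qed
    finally show ?case .
  qed
  with c show ?thesis by blast
qed

lemma summable_deviation_prob:
  assumes e: "0 < \<epsilon>"
  shows "summable (\<lambda>n. gibbs_prob g (\<lambda>k. \<beta> * w k) n (deviates g w \<alpha> \<epsilon> n))"
proof -
  let ?P = "\<lambda>n. gibbs_prob g (\<lambda>k. \<beta> * w k) n"
  let ?dev = "\<lambda>\<sigma> n x. \<sigma> * (energy g w n x - real n * \<alpha>) > real n * \<epsilon>"
  obtain c d where c: "c > 0" "\<forall>\<^sub>F n in sequentially. ?P n (?dev 1 n) \<le> exp (- (c * real n))"
    and d: "d > 0" "\<forall>\<^sub>F n in sequentially. ?P n (?dev (-1) n) \<le> exp (- (d * real n))"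
    using one_sided_deviation[OF e, of 1] one_sided_deviation[OF e, of "-1"] by auto
  have geo: "summable (\<lambda>n. exp (- (r * real n)))" if "r > 0" for r
    using that summable_geometric[of "exp (- r)"] by (simp add: exp_of_nat_mult[symmetric] mult.commute)
  have "\<forall>\<^sub>F n in sequentially. norm (?P n (deviates g w \<alpha> \<epsilon> n)) \<le> exp (- (c * real n)) + exp (- (d * real n))"
    using c(2) d(2)
  proof eventually_elim
    case (elim n)
    have "?P n (deviates g w \<alpha> \<epsilon> n) \<le> ?P n (\<lambda>x. \<exists>\<sigma>\<in>{1, -1}. ?dev \<sigma> n x)"
      by (rule gibbs_prob_mono) (auto simp: deviates_def abs_if split: if_splits)
    also have "\<dots> \<le> (\<Sum>\<sigma>\<in>{1, -1}. ?P n (?dev \<sigma> n))"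
      by (rule gibbs_prob_Ex_le) simp
    finally show ?case
      using elim by (simp add: gibbs_prob_nonneg)
  qed
  then show ?thesis
    by (rule summable_comparison_test_ev) (intro summable_add geo c d)
qed

lemma deviation_tail:
  assumes "0 < \<epsilon>" "0 < e"
  shows "\<exists>m\<ge>k. \<forall>l. (\<Sum>n\<in>{m..<l}. gibbs_prob g (\<lambda>k. \<beta> * w k) n (deviates g w \<alpha> \<epsilon> n)) \<le> e"
proof -
  obtain m where "\<And>i l. i \<ge> m \<Longrightarrow>
      norm (\<Sum>n\<in>{i..<l}. gibbs_prob g (\<lambda>k. \<beta> * w k) n (deviates g w \<alpha> \<epsilon> n)) < e"
    using summable_deviation_prob[OF assms(1)] \<open>0 < e\<close> unfolding summable_Cauchy by blast
  from this[of "max k m"] show ?thesis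
    by (intro exI[of _ "max k m"]) (auto simp: less_imp_le abs_less_iff)
qed

text \<open>A quantitative Borel--Cantelli argument at finite volume: choose \<open>m k\<close> so late that the
  deviations by \<open>1 / (k + 1)\<close> after time \<open>m k\<close> have total probability of order
  \<open>2 ^ (- k)\<close>. One sequence \<open>m\<close> serves all volumes \<open>l\<close>, because \<open>gibbs_prob_extend\<close>
  bounds the probabilities at volume \<open>l\<close> by those at volume \<open>n\<close>.\<close>

lemma uniformly_good_words:
  assumes B: "\<And>k a b. \<bar>\<beta> * w k * g a b\<bar> \<le> B"
  shows "\<exists>m. \<forall>l. gibbs_prob g (\<lambda>k. \<beta> * w k) l
    (\<lambda>x. \<forall>k. \<forall>n\<in>{m k..l}. \<not> deviates g w \<alpha> (1 / real (Suc k)) n x) \<ge> 1 / 2"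
proof -
  let ?P = "\<lambda>n. gibbs_prob g (\<lambda>k. \<beta> * w k) n"
  let ?dev = "\<lambda>k n. deviates g w \<alpha> (1 / real (Suc k)) n"
  \<comment> \<open>the first factor absorbs the constant lost in the comparison of volumes\<close>
  define e where "e k = exp (- (2 * B)) * (1 / 2) ^ (k + 2)" for k
  have "\<forall>k. \<exists>m\<ge>k. \<forall>l. (\<Sum>n\<in>{m..<l}. ?P n (?dev k n)) \<le> e k"
    by (intro allI deviation_tail) (simp_all add: e_def)
  then obtain m where m: "\<And>k. m k \<ge> k" "\<And>k l. (\<Sum>n\<in>{m k..<l}. ?P n (?dev k n)) \<le> e k"
    by metis
  have "?P l (\<lambda>x. \<not> (\<forall>k. \<forall>n\<in>{m k..l}. \<not> ?dev k n x)) \<le> 1 / 2" for l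
  proof -
    have "?P l (\<lambda>x. \<not> (\<forall>k. \<forall>n\<in>{m k..l}. \<not> ?dev k n x))
        \<le> ?P l (\<lambda>x. \<exists>k\<in>{..l}. \<exists>n\<in>{m k..l}. ?dev k n x)"
    proof (rule gibbs_prob_mono)
      fix x
      assume "\<not> (\<forall>k. \<forall>n\<in>{m k..l}. \<not> ?dev k n x)"
      then obtain k n where "n \<in> {m k..l}" "?dev k n x" by blast
      \<comment> \<open>only finitely many \<open>k\<close> matter at volume \<open>l\<close>, since \<open>m k \<ge> k\<close>\<close>
      moreover from this have "k \<in> {..l}" using m(1)[of k] by simp
      ultimately show "\<exists>k\<in>{..l}. \<exists>n\<in>{m k..l}. ?dev k n x" by blast
    qed
    also have "\<dots> \<le> (\<Sum>k\<in>{..l}. ?P l (\<lambda>x. \<exists>n\<in>{m k..l}. ?dev k n x))"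
      by (rule gibbs_prob_Ex_le) simp
    also have "\<dots> \<le> (\<Sum>k\<in>{..l}. \<Sum>n\<in>{m k..l}. ?P l (?dev k n))"
      by (intro sum_mono gibbs_prob_Ex_le) simp
    also have "\<dots> \<le> (\<Sum>k\<in>{..l}. \<Sum>n\<in>{m k..l}. exp (2 * B) * ?P n (?dev k n))"
      by (intro sum_mono gibbs_prob_extend B deviates_cong) auto
    also have "\<dots> = (\<Sum>k\<in>{..l}. exp (2 * B) * (\<Sum>n\<in>{m k..<Suc l}. ?P n (?dev k n)))"
      by (simp add: sum_distrib_left atLeastLessThanSuc_atLeastAtMost)
    also have "\<dots> \<le> (\<Sum>k\<in>{..l}. exp (2 * B) * e k)"
      by (intro sum_mono mult_left_mono m) simp
    also have "\<dots> = (\<Sum>k<Suc l. (1 / 2) ^ k) / 4"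
    proof -
      have "exp (2 * B) * e k = (1 / 2) ^ k / 4" for k
        by (simp add: e_def exp_minus field_simps)
      then have "(\<Sum>k\<le>l. exp (2 * B) * e k) = (\<Sum>k\<le>l. (1 / 2) ^ k / 4)"
        by (simp only:)
      then show ?thesis
        by (simp add: sum_divide_distrib lessThan_Suc_atMost)
    qed
    also have "\<dots> \<le> 1 / 2"
      by (subst geometric_sum) (simp_all add: field_simps)
    finally show ?thesis .
  qed
  then have "\<forall>l. ?P l (\<lambda>x. \<forall>k. \<forall>n\<in>{m k..l}. \<not> ?dev k n x) \<ge> 1 / 2"
    unfolding gibbs_prob_not by (simp add: algebra_simps)
  then show ?thesis by blast
qed

end

section \<open>Lower bound for covers of the level set\<close>

text \<open>Koenig's lemma, equivalently compactness of the sequence space: the sets \<open>{z. Q m z}\<close> are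
  decreasing, nonempty and closed, being determined by finitely many letters.\<close>

lemma koenig_sequences:
  fixes Q :: "nat \<Rightarrow> (nat \<Rightarrow> 's::finite) \<Rightarrow> bool"
  assumes ex: "\<And>m. \<exists>z. Q m z"
    and anti: "\<And>m l z. m \<le> l \<Longrightarrow> Q l z \<Longrightarrow> Q m z"
    and loc: "\<And>m x y. (\<And>k. k < Suc m \<Longrightarrow> x k = y k) \<Longrightarrow> Q m x \<Longrightarrow> Q m y"
  shows "\<exists>z. \<forall>m. Q m z"
proof -
  \<comment> \<open>prefixes that extend to a witness for every \<open>m\<close>\<close>
  define alive where "alive n x \<longleftrightarrow> (\<forall>m. \<exists>z. Q m z \<and> (\<forall>k<n. z k = x k))" for n x
  have "\<exists>f. \<forall>n. alive n (f n) \<and> (\<forall>k<n. f (Suc n) k = f n k)"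
  proof (rule dependent_nat_choice)
    show "\<exists>x. alive 0 x" using ex by (simp add: alive_def)
  next
    fix x n
    assume x: "alive n x"
    have "\<exists>b. alive (Suc n) (x(n := b))"
    proof (rule ccontr)
      assume "\<not> ?thesis"
      then have "\<forall>b. \<exists>m. \<forall>z. Q m z \<longrightarrow> \<not> (\<forall>k<Suc n. z k = (x(n := b)) k)"
        unfolding alive_def by blast
      then obtain m where m: "\<And>b z. Q (m b) z \<Longrightarrow> \<not> (\<forall>k<Suc n. z k = (x(n := b)) k)"
        by metis
      obtain z where z: "Q (Max (range m)) z" "\<forall>k<n. z k = x k"
        using x unfolding alive_def by blast
      have "Q (m (z n)) z"
        by (rule anti[OF _ z(1)]) simp
      moreover have "\<forall>k<Suc n. z k = (x(n := z n)) k"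
        using z(2) by (simp add: less_Suc_eq)
      ultimately show False using m by blast
    qed
    then obtain b where "alive (Suc n) (x(n := b))" ..
    then show "\<exists>y. alive (Suc n) y \<and> (\<forall>k<n. y k = x k)"
      by (intro exI[of _ "x(n := b)"]) simp
  qed
  then obtain f where f: "\<And>n. alive n (f n)" "\<And>n k. k < n \<Longrightarrow> f (Suc n) k = f n k"
    by blast
  have f_eq: "f (Suc k + i) k = f (Suc k) k" for k i
    by (induction i) (simp_all add: f(2))
  have "Q m (\<lambda>k. f (Suc k) k)" for m
  proof -
    obtain z where z: "Q m z" "\<forall>k<Suc m. z k = f (Suc m) k"
      using f(1)[of "Suc m"] unfolding alive_def by blast
    show ?thesis
    proof (rule loc[OF _ z(1)])
      fix k
      assume "k < Suc m"
      then show "z k = f (Suc k) k"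
        using z(2) f_eq[of k "m - k"] by simp
    qed
  qed
  then show ?thesis by blast
qed


text \<open>The form in which a lower bound for the Hausdorff dimension is used: the \<open>s\<close>-sum of every cover
  by long cylinders is at least \<open>1 / 2\<close>, already on a finite subfamily. The exponent may be
  negative: the property then still says that the empty family does not cover \<open>E\<close>.\<close>

definition heavy_covers :: "real \<Rightarrow> real \<Rightarrow> nat \<Rightarrow> (nat \<Rightarrow> 's) set \<Rightarrow> bool" where
  "heavy_covers q s n E \<longleftrightarrow> (\<forall>(I :: nat set) c x.
     (\<forall>i\<in>I. n \<le> c i) \<longrightarrow> E \<subseteq> (\<Union>i\<in>I. cylinder (c i) (x i)) \<longrightarrow>
     (\<exists>J\<subseteq>I. finite J \<and> 1 / 2 \<le> (\<Sum>i\<in>J. q powr (- s * real (c i)))))"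

context
  fixes g :: "'s::finite \<Rightarrow> 's \<Rightarrow> real" and w :: "nat \<Rightarrow> real" and \<psi> :: "real \<Rightarrow> real"
    and \<alpha> \<beta> :: real
  assumes pressure_limit:
      "\<And>b. (\<lambda>n. ln (partition_sum g (\<lambda>k. b * w k) n) / real n) \<longlonglongrightarrow> \<psi> b"
    and deriv: "(\<psi> has_real_derivative \<alpha>) (at \<beta>)"
begin


text \<open>The mass distribution principle, with the Gibbs measure of one large finite volume in place of
  a limit measure. The set \<open>G\<close> of sequences that are good at all times is contained in the level
  set, and a long cylinder that meets \<open>G\<close> has Gibbs probability at most \<open>q powr (- s * length)\<close> in
  every larger volume. By compactness a cover of \<open>G\<close> covers, for some \<open>l\<close>, all words that are
  good up to time \<open>l\<close>, with cylinders of length at most \<open>l + 1\<close>; those words have Gibbs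
  probability at least \<open>1 / 2\<close>.\<close>

lemma cylinder_cover_bound:
  fixes q s :: real
  assumes B: "\<And>k a b. \<bar>\<beta> * w k * g a b\<bar> \<le> B" and q: "1 < q"
    and s: "s * ln q < \<psi> \<beta> - \<alpha> * \<beta>"
  shows "\<exists>n. heavy_covers q s n {x. (\<lambda>n. energy g w n x / real n) \<longlonglongrightarrow> \<alpha>}"
proof -
  let ?E = "{x. (\<lambda>n. energy g w n x / real n) \<longlonglongrightarrow> \<alpha>}"
  let ?P = "\<lambda>n. gibbs_prob g (\<lambda>k. \<beta> * w k) n"
  let ?dev = "\<lambda>k. deviates g w \<alpha> (1 / real (Suc k))"
  obtain m where m: "\<And>l. ?P l (\<lambda>x. \<forall>k. \<forall>n\<in>{m k..l}. \<not> ?dev k n x) \<ge> 1 / 2"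
    using uniformly_good_words[OF pressure_limit deriv, of B] B by blast
  define good where "good l x \<longleftrightarrow> (\<forall>k. \<forall>n\<in>{m k..l}. \<not> ?dev k n x)" for l x
  define G where "G = {x. \<forall>l. good l x}"
  have G_not_dev: "\<not> ?dev k n x" if "x \<in> G" "m k \<le> n" for x k n
    using that unfolding G_def good_def mem_Collect_eq by (meson atLeastAtMost_iff order_refl)
  have "G \<subseteq> ?E"
  proof
    fix x
    assume x: "x \<in> G"
    have "(\<lambda>n. energy g w n x / real n) \<longlonglongrightarrow> \<alpha>"
    proof (rule metric_LIMSEQ_I)
      fix r :: real
      assume "0 < r"
      then obtain k where k: "1 / real (Suc k) < r"
        using reals_Archimedean by (auto simp: inverse_eq_divide)
      show "\<exists>n0. \<forall>n\<ge>n0. dist (energy g w n x / real n) \<alpha> < r"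
      proof (intro exI allI impI)
        fix n
        assume n: "Suc (m k) \<le> n"
        have "\<bar>energy g w n x / real n - \<alpha>\<bar> = \<bar>energy g w n x - real n * \<alpha>\<bar> / real n"
        proof -
          have "energy g w n x / real n - \<alpha> = (energy g w n x - real n * \<alpha>) / real n"
            using n by (simp add: diff_divide_distrib)
          then show ?thesis by (simp add: abs_divide)
        qed
        also have "\<dots> \<le> 1 / real (Suc k)"
          using G_not_dev[OF x, of k n] n
          by (simp add: deviates_def not_less pos_divide_le_eq mult.commute)
        finally show "dist (energy g w n x / real n) \<alpha> < r"
          using k by (simp add: dist_real_def)
      qed
    qed
    then show "x \<in> ?E" by simp
  qed
  \<comment> \<open>the gap is split in three: the deviation of the energy, that of the partition sum, and the rate that beats the constants\<close>
  define \<eta> where "\<eta> = (\<psi> \<beta> - \<alpha> * \<beta> - s * ln q) / 3"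
  have \<eta>: "0 < \<eta>" "\<psi> \<beta> - \<alpha> * \<beta> = s * ln q + 3 * \<eta>"
    using s by (simp add: \<eta>_def) (simp add: \<eta>_def field_simps)
  obtain k where k: "\<bar>\<beta>\<bar> * (1 / real (Suc k)) \<le> \<eta>"
    using inverse_Suc_slack[OF \<eta>(1)] by blast
  define Z where "Z n = partition_sum g (\<lambda>k. \<beta> * w k) n" for n
  have Z: "0 < Z n" for n by (simp add: Z_def partition_sum_pos)
  have "\<forall>\<^sub>F n in sequentially. \<psi> \<beta> - \<eta> < ln (Z n) / real n"
    unfolding Z_def by (rule order_tendstoD(1)[OF pressure_limit]) (use \<eta> in simp)
  moreover have "\<forall>\<^sub>F n in sequentially. 2 * B + s * ln q \<le> real n * \<eta>"
  proof -
    have "\<forall>\<^sub>F n in sequentially. (2 * B + s * ln q) / \<eta> \<le> real n"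
      using filterlim_real_sequentially by (simp add: filterlim_at_top)
    then show ?thesis
      by eventually_elim (use \<eta> in \<open>simp add: pos_divide_le_eq\<close>)
  qed
  moreover have "\<forall>\<^sub>F n in sequentially. m k + 1 \<le> n"
    by (rule eventually_ge_at_top)
  ultimately have "\<forall>\<^sub>F n in sequentially. \<psi> \<beta> - \<eta> < ln (Z n) / real n \<and>
      2 * B + s * ln q \<le> real n * \<eta> \<and> m k + 1 \<le> n"
    by eventually_elim simp
  then obtain n1 where n1: "\<And>n. n1 \<le> n \<Longrightarrow> \<psi> \<beta> - \<eta> < ln (Z n) / real n \<and>
      2 * B + s * ln q \<le> real n * \<eta> \<and> m k + 1 \<le> n"
    unfolding eventually_sequentially by blast
  have weight: "?P l (\<lambda>z. z \<in> cylinder c x) \<le> q powr (- s * real c)"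
    if "x \<in> G" "Suc n1 \<le> c" "c \<le> Suc l" for x c l
  proof -
    obtain n where n: "c = Suc n" "n1 \<le> n" "n \<le> l"
      using \<open>Suc n1 \<le> c\<close> \<open>c \<le> Suc l\<close> by (cases c) auto
    have n': "0 < real n" "m k \<le> n" using n1[OF n(2)] by auto
    have "?P l (\<lambda>z. z \<in> cylinder c x) \<le> exp (2 * B) * (exp (energy g (\<lambda>k. \<beta> * w k) n x) / Z n)"
      unfolding n(1) Z_def by (rule cylinder_weight_le[OF _ n(3)]) (rule B)
    also have "\<dots> = exp (2 * B + \<beta> * energy g w n x - ln (Z n))"
      using Z[of n] by (simp add: exp_add exp_diff energy_scale)
    also have "\<dots> \<le> exp (- s * real c * ln q)"
    proof -
      have 1: "\<beta> * energy g w n x \<le> real n * (\<alpha> * \<beta>) + real n * \<eta>"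
        using nondeviating_energy_bound[OF G_not_dev[OF \<open>x \<in> G\<close> n'(2)] k]
        by linarith
      have "(\<psi> \<beta> - \<eta>) * real n \<le> ln (Z n)"
        using n1[OF n(2)] n' by (simp add: pos_less_divide_eq less_imp_le)
      moreover have "(\<psi> \<beta> - \<eta>) * real n = real n * (\<alpha> * \<beta>) + real n * (s * ln q) + 2 * (real n * \<eta>)"
      proof -
        have "\<psi> \<beta> = \<alpha> * \<beta> + s * ln q + 3 * \<eta>" using \<eta>(2) by simp
        then show ?thesis by (simp add: algebra_simps)
      qed
      moreover have "2 * B + s * ln q \<le> real n * \<eta>"
        using n1[OF n(2)] by simp
      moreover have "- s * real c * ln q = - (real n * (s * ln q)) - s * ln q"
        by (simp add: n(1) algebra_simps)
      ultimately show ?thesis using 1 by simp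
    qed
    finally show ?thesis
      using q by (simp add: powr_def)
  qed
  show ?thesis
    unfolding heavy_covers_def
  proof (intro exI[of _ "Suc n1"] allI impI)
    fix I :: "nat set" and c :: "nat \<Rightarrow> nat" and x :: "nat \<Rightarrow> nat \<Rightarrow> 's"
    assume c: "\<forall>i\<in>I. Suc n1 \<le> c i" and cover: "?E \<subseteq> (\<Union>i\<in>I. cylinder (c i) (x i))"
    define I' where "I' = {i\<in>I. cylinder (c i) (x i) \<inter> G \<noteq> {}}"
    have "\<exists>l. \<forall>z. good l z \<longrightarrow> (\<exists>i\<in>I'. c i \<le> Suc l \<and> z \<in> cylinder (c i) (x i))"
    proof (rule ccontr)
      assume neg: "\<not> ?thesis"
      define Q where "Q l z \<longleftrightarrow> good l z \<and> (\<forall>i\<in>I'. c i \<le> Suc l \<longrightarrow> z \<notin> cylinder (c i) (x i))" for l z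
      have "\<exists>z. \<forall>l. Q l z"
      proof (rule koenig_sequences)
        show "\<exists>z. Q l z" for l
          using neg unfolding Q_def by blast
        show "Q l z" if "l \<le> l'" "Q l' z" for l l' z
          using that unfolding Q_def good_def by (meson atLeastAtMost_iff le_SucI le_trans Suc_le_mono)
        show "Q l z'" if eq: "\<And>k. k < Suc l \<Longrightarrow> z k = z' k" and "Q l z" for l z z'
        proof -
          have "?dev k n z \<longleftrightarrow> ?dev k n z'" if "n \<le> l" for k n
            by (rule deviates_cong) (use eq that in simp)
          then have "good l z'"
            using \<open>Q l z\<close> unfolding Q_def good_def by auto
          moreover have "z' \<notin> cylinder (c i) (x i)" if "i \<in> I'" "c i \<le> Suc l" for i
            using \<open>Q l z\<close> eq that unfolding Q_def cylinder_def by fastforce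
          ultimately show ?thesis by (simp add: Q_def)
        qed
      qed
      then obtain z where z: "\<And>l. Q l z" by blast
      then have "z \<in> G" by (simp add: G_def Q_def)
      then obtain i where i: "i \<in> I" "z \<in> cylinder (c i) (x i)"
        using \<open>G \<subseteq> ?E\<close> cover by blast
      then have "i \<in> I'" using \<open>z \<in> G\<close> by (auto simp: I'_def)
      then show False
        using z[of "c i"] i(2) by (simp add: Q_def)
    qed
    then obtain l where l: "\<And>z. good l z \<Longrightarrow> \<exists>i\<in>I'. c i \<le> Suc l \<and> z \<in> cylinder (c i) (x i)"
      by blast
    then obtain h where h: "\<And>z. good l z \<Longrightarrow> h z \<in> I' \<and> c (h z) \<le> Suc l \<and> z \<in> cylinder (c (h z)) (x (h z))"
      by metis
    define J where "J = h ` {z\<in>words (Suc l). good l z}"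
    have "finite J" by (simp add: J_def)
    have J: "i \<in> I' \<and> c i \<le> Suc l" if "i \<in> J" for i
      using that h by (auto simp: J_def)
    have "1 / 2 \<le> ?P l (good l)"
      using m[of l] by (simp add: good_def[abs_def])
    also have "\<dots> \<le> ?P l (\<lambda>z. \<exists>i\<in>J. z \<in> cylinder (c i) (x i))"
      by (rule gibbs_prob_mono) (use h in \<open>auto simp: J_def\<close>)
    also have "\<dots> \<le> (\<Sum>i\<in>J. ?P l (\<lambda>z. z \<in> cylinder (c i) (x i)))"
      by (rule gibbs_prob_Ex_le) fact
    also have "\<dots> \<le> (\<Sum>i\<in>J. q powr (- s * real (c i)))"
    proof (rule sum_mono)
      fix i
      assume i: "i \<in> J"
      then obtain y where y: "y \<in> cylinder (c i) (x i)" "y \<in> G"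
        using J by (auto simp: I'_def)
      then have "cylinder (c i) (x i) = cylinder (c i) y"
        by (auto simp: cylinder_def)
      then show "?P l (\<lambda>z. z \<in> cylinder (c i) (x i)) \<le> q powr (- s * real (c i))"
        using weight[OF y(2), of "c i" l] J[OF i] c by (simp add: I'_def)
    qed
    finally show "\<exists>J\<subseteq>I. finite J \<and> 1 / 2 \<le> (\<Sum>i\<in>J. q powr (- s * real (c i)))"
      using J \<open>finite J\<close> by (intro exI[of _ J]) (auto simp: I'_def)
  qed
qed

end

section \<open>Hausdorff and packing measures of sets of sequences\<close>

lemma sum_power_tail_le:
  fixes r :: real
  assumes "finite A" "A \<subseteq> {n..}" "0 < r" "r < 1"
  shows "(\<Sum>i\<in>A. r ^ i) \<le> r ^ n / (1 - r)"
proof -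
  have "inj_on (\<lambda>i. i - n) A"
    by (rule inj_onI) (use assms(2) in \<open>metis atLeast_iff eq_diff_iff subsetD\<close>)
  then have "(\<Sum>i\<in>A. r ^ i) = (\<Sum>j\<in>(\<lambda>i. i - n) ` A. r ^ (n + j))"
    by (subst sum.reindex) (use assms(2) in \<open>auto intro!: sum.cong\<close>)
  also have "\<dots> = r ^ n * (\<Sum>j\<in>(\<lambda>i. i - n) ` A. r ^ j)"
    by (simp add: power_add sum_distrib_left)
  also have "\<dots> \<le> r ^ n * (\<Sum>j. r ^ j)"
    using assms by (intro mult_left_mono sum_le_suminf summable_geometric) auto
  also have "\<dots> = r ^ n / (1 - r)"
    using assms by (simp add: suminf_geometric)
  finally show ?thesis .
qed

context
  assumes card_alphabet: "2 \<le> CARD('s::finite)"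
begin

interpretation seqs: Metric_space "UNIV :: (nat \<Rightarrow> 's) set" seq_dist
  by (rule Metric_space_seq_dist)

lemma alphabet_gt_1: "1 < real CARD('s)"
  using card_alphabet by linarith

lemma seq_dist_le_iff_cylinder:
  fixes x y :: "nat \<Rightarrow> 's"
  shows "seq_dist x y \<le> (1 / real CARD('s)) ^ n \<longleftrightarrow> y \<in> cylinder n x"
proof (cases "x = y")
  case False
  define k where "k = (LEAST k. x k \<noteq> y k)"
  have "\<exists>k. x k \<noteq> y k" using False by auto
  then have k: "x k \<noteq> y k" unfolding k_def by (rule LeastI_ex)
  have less: "x j = y j" if "j < k" for j
    using not_less_Least[of j "\<lambda>k. x k \<noteq> y k"] that by (auto simp: k_def)
  have "(1 / real CARD('s)) ^ k \<le> (1 / real CARD('s)) ^ n \<longleftrightarrow> n \<le> k"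
    using alphabet_gt_1 by (intro power_decreasing_iff) auto
  also have "\<dots> \<longleftrightarrow> y \<in> cylinder n x"
    using k less by (auto simp: cylinder_def) (metis not_le)
  finally show ?thesis
    using False by (simp add: seq_dist_def k_def)
qed (simp add: seq_dist_def cylinder_def)

lemma mcball_eq_cylinder:
  fixes x :: "nat \<Rightarrow> 's"
  shows "seqs.mcball x ((1 / real CARD('s)) ^ n) = cylinder n x"
  by (auto simp: seqs.mcball_def seq_dist_le_iff_cylinder)

lemma ediam_cylinder_le:
  fixes x :: "nat \<Rightarrow> 's"
  shows "seqs.ediam (cylinder n x) \<le> ennreal ((1 / real CARD('s)) ^ n)"
  unfolding seqs.ediam_def
proof (rule SUP_least)
  fix p assume "p \<in> cylinder n x \<times> cylinder n x"
  then have "snd p \<in> cylinder n (fst p)"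
    by (auto simp: cylinder_def)
  then show "ennreal (seq_dist (fst p) (snd p)) \<le> ennreal ((1 / real CARD('s)) ^ n)"
    by (intro ennreal_leI) (simp add: seq_dist_le_iff_cylinder)
qed

lemma power_level_powr:
  "((1 / real CARD('s)) ^ n) powr s = real CARD('s) powr (- s * real n)"
  using alphabet_gt_1
  by (simp add: powr_realpow[symmetric] powr_powr powr_minus_divide[symmetric] powr_divide mult.commute)

lemma level_below:
  assumes "0 < r"
  shows "\<exists>n. (1 / real CARD('s)) ^ n \<le> r"
  using real_arch_pow_inv[of r "1 / real CARD('s)"] alphabet_gt_1 assms by (auto intro: less_imp_le)

text \<open>The diameter of a set with two points is attained and is the radius of the smallest
  cylinder containing it. A singleton has diameter 0, hence the slack \<open>e\<close>.\<close>

lemma small_set_in_cylinder: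
  fixes U :: "(nat \<Rightarrow> 's) set"
  assumes s: "0 \<le> s" and e: "0 < e" and U: "U \<noteq> {}"
    and diam: "seqs.ediam U \<le> ennreal ((1 / real CARD('s)) ^ n)"
  shows "\<exists>c\<ge>n. (\<forall>x\<in>U. U \<subseteq> cylinder c x) \<and>
    ennreal (real CARD('s) powr (- s * real c)) \<le> seqs.diam_powr s U + ennreal e"
proof (cases "\<exists>k. \<exists>x\<in>U. \<exists>y\<in>U. x k \<noteq> y k")
  case True
  define c where "c = (LEAST k. \<exists>x\<in>U. \<exists>y\<in>U. x k \<noteq> y k)"
  obtain x y where xy: "x \<in> U" "y \<in> U" "x c \<noteq> y c"
    using LeastI_ex[OF True] unfolding c_def by blast
  have agree: "z k = z' k" if "k < c" "z \<in> U" "z' \<in> U" for k z z'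
    using not_less_Least[of k "\<lambda>k. \<exists>x\<in>U. \<exists>y\<in>U. x k \<noteq> y k"] that unfolding c_def by blast
  have "(LEAST k. x k \<noteq> y k) = c"
    by (rule Least_equality) (use xy agree in \<open>auto simp: not_less[symmetric]\<close>)
  then have "seq_dist x y = (1 / real CARD('s)) ^ c"
    using xy by (auto simp: seq_dist_def)
  then have low: "ennreal ((1 / real CARD('s)) ^ c) \<le> seqs.ediam U"
    unfolding seqs.ediam_def by (intro SUP_upper2[of "(x, y)"]) (use xy in auto)
  have "ennreal ((1 / real CARD('s)) ^ c) \<le> ennreal ((1 / real CARD('s)) ^ n)"
    using low diam by (rule order_trans)
  then have "(1 / real CARD('s)) ^ c \<le> (1 / real CARD('s)) ^ n"
    by (subst (asm) ennreal_le_iff) auto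
  then have "n \<le> c"
    using alphabet_gt_1 by (subst (asm) power_decreasing_iff) auto
  moreover have "\<forall>x\<in>U. U \<subseteq> cylinder c x"
    using agree by (auto simp: cylinder_def)
  moreover have "ennreal (real CARD('s) powr (- s * real c)) \<le> seqs.diam_powr s U"
  proof (cases "s = 0")
    case False
    have "seqs.ediam U < top"
      using diam by (rule order_le_less_trans) simp
    then have "(1 / real CARD('s)) ^ c \<le> enn2real (seqs.ediam U)"
      using enn2real_mono[OF low] by simp
    then have "((1 / real CARD('s)) ^ c) powr s \<le> enn2real (seqs.ediam U) powr s"
      using s by (intro powr_mono2) auto
    then show ?thesis
      using False U by (simp add: seqs.diam_powr_def power_level_powr ennreal_leI)
  qed (use U alphabet_gt_1 in \<open>simp add: seqs.diam_powr_def\<close>)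
  then have "ennreal (real CARD('s) powr (- s * real c)) \<le> seqs.diam_powr s U + ennreal e"
    by (rule order_trans) simp
  ultimately show ?thesis by blast
next
  case False
  then have sub: "U \<subseteq> cylinder c x" if "x \<in> U" for c x
    using that by (auto simp: cylinder_def)
  show ?thesis
  proof (cases "s = 0")
    case True
    then show ?thesis
      using sub U alphabet_gt_1 by (intro exI[of _ n]) (auto simp: seqs.diam_powr_def)
  next
    case False
    then have "real CARD('s) powr (- s) < 1"
      using s alphabet_gt_1 by (simp add: powr_less_one)
    then obtain m where m: "(real CARD('s) powr (- s)) ^ m < e"
      using real_arch_pow_inv[OF e] by blast
    have "real CARD('s) powr (- s * real (max n m)) \<le> real CARD('s) powr (- s * real m)"
      using s alphabet_gt_1 by (intro powr_mono mult_left_mono_neg) auto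
    also have "\<dots> = (real CARD('s) powr (- s)) ^ m"
      using powr_powr[of "real CARD('s)" "- s" "real m"] alphabet_gt_1
      by (simp add: powr_realpow)
    finally have "ennreal (real CARD('s) powr (- s * real (max n m))) \<le> ennreal e"
      using m by (intro ennreal_leI) simp
    then have "ennreal (real CARD('s) powr (- s * real (max n m))) \<le> seqs.diam_powr s U + ennreal e"
      by (rule order_trans) simp
    then show ?thesis
      using sub by (intro exI[of _ "max n m"]) auto
  qed
qed

text \<open>Replacing the sets of a cover by cylinders costs an arbitrarily small summable error, so a
  cover with a small sum would contradict the lower bound for cylinder covers.\<close>

lemma hausdorff_measure_nonzero:
  fixes E :: "(nat \<Rightarrow> 's) set"
  assumes s: "0 \<le> s"
    and covers: "heavy_covers (real CARD('s)) s n E"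
  shows "seqs.hausdorff_measure s E \<noteq> 0"
proof
  assume zero: "seqs.hausdorff_measure s E = 0"
  let ?\<delta> = "(1 / real CARD('s)) ^ n"
  have "seqs.hausdorff_content ?\<delta> s E \<le> seqs.hausdorff_measure s E"
    unfolding seqs.hausdorff_measure_def by (rule SUP_upper) (use alphabet_gt_1 in simp)
  then have "seqs.hausdorff_content ?\<delta> s E < ennreal (1 / 4)"
    by (simp add: zero)
  then obtain U where U: "E \<subseteq> (\<Union>i. U i)" "\<And>i :: nat. seqs.ediam (U i) \<le> ennreal ?\<delta>"
    "(\<Sum>i. seqs.diam_powr s (U i)) < ennreal (1 / 4)"
    unfolding seqs.hausdorff_content_def INF_less_iff by auto
  define I where "I = {i. U i \<noteq> {}}"
  define e :: "nat \<Rightarrow> real" where "e i = (1 / 2) ^ i / 8" for i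
  have "\<forall>i\<in>I. \<exists>c\<ge>n. (\<forall>x\<in>U i. U i \<subseteq> cylinder c x) \<and>
      ennreal (real CARD('s) powr (- s * real c)) \<le> seqs.diam_powr s (U i) + ennreal (e i)"
    by (intro ballI small_set_in_cylinder s U) (auto simp: I_def e_def)
  then obtain c where c: "\<And>i. i \<in> I \<Longrightarrow> n \<le> c i" "\<And>i x. i \<in> I \<Longrightarrow> x \<in> U i \<Longrightarrow> U i \<subseteq> cylinder (c i) x"
      "\<And>i. i \<in> I \<Longrightarrow> ennreal (real CARD('s) powr (- s * real (c i))) \<le> seqs.diam_powr s (U i) + ennreal (e i)"
    by metis
  define x where "x i = (SOME y. y \<in> U i)" for i
  have x: "x i \<in> U i" if "i \<in> I" for i
    using that by (simp add: I_def x_def some_in_eq)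
  have "E \<subseteq> (\<Union>i\<in>I. cylinder (c i) (x i))"
  proof
    fix y assume "y \<in> E"
    then obtain i where i: "y \<in> U i" using U(1) by blast
    then have "i \<in> I" by (auto simp: I_def)
    then show "y \<in> (\<Union>i\<in>I. cylinder (c i) (x i))"
      using c(2)[OF _ x] i by blast
  qed
  then obtain J where J: "J \<subseteq> I" "finite J" "1 / 2 \<le> (\<Sum>i\<in>J. real CARD('s) powr (- s * real (c i)))"
    using covers[unfolded heavy_covers_def, rule_format, of I c x] c(1) by blast
  have "(\<lambda>i. (1 / 2 :: real) ^ i / 8) sums (1 / 4)"
    using sums_divide[OF geometric_sums[of "1 / 2 :: real"], of 8] by simp
  then have sums: "summable e" "suminf e = 1 / 4"
    by (auto simp: e_def[abs_def] sums_iff)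
  have "ennreal (1 / 2) \<le> ennreal (\<Sum>i\<in>J. real CARD('s) powr (- s * real (c i)))"
    by (rule ennreal_leI) (rule J(3))
  also have "\<dots> = (\<Sum>i\<in>J. ennreal (real CARD('s) powr (- s * real (c i))))"
    by (simp add: sum_ennreal)
  also have "\<dots> \<le> (\<Sum>i\<in>J. seqs.diam_powr s (U i) + ennreal (e i))"
    using J(1) c(3) by (intro sum_mono) auto
  also have "\<dots> = (\<Sum>i\<in>J. seqs.diam_powr s (U i)) + ennreal (\<Sum>i\<in>J. e i)"
    by (simp add: sum.distrib sum_ennreal e_def)
  also have "\<dots> \<le> (\<Sum>i. seqs.diam_powr s (U i)) + ennreal (1 / 4)"
  proof (rule add_mono)
    show "(\<Sum>i\<in>J. seqs.diam_powr s (U i)) \<le> (\<Sum>i. seqs.diam_powr s (U i))"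
      by (intro sum_le_suminf summableI J) auto
    show "ennreal (\<Sum>i\<in>J. e i) \<le> ennreal (1 / 4)"
      using sum_le_suminf[OF sums(1) J(2)] by (intro ennreal_leI) (simp add: sums(2) e_def)
  qed
  also have "\<dots> < ennreal (1 / 4) + ennreal (1 / 4)"
    using U(3) by (simp add: ennreal_add_left_cancel_less add.commute)
  also have "\<dots> = ennreal (1 / 2)"
    by (simp flip: ennreal_plus)
  finally show False by simp
qed

text \<open>The cylinders of one length that meet \<open>F\<close> are disjoint balls, hence a packing once each is
  centred in \<open>F\<close>, and at the same time they cover \<open>F\<close>.\<close>

lemma hausdorff_content_le_packing_premeasure:
  fixes F :: "(nat \<Rightarrow> 's) set"
  assumes s: "0 \<le> s" and \<delta>: "0 < \<delta>"
  shows "seqs.hausdorff_content \<delta> s F \<le> seqs.packing_premeasure s F"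
  unfolding seqs.packing_premeasure_def
proof (rule INF_greatest)
  fix \<delta>' :: real
  assume "\<delta>' \<in> {0<..}"
  then obtain n where n: "(1 / real CARD('s)) ^ n \<le> min \<delta> \<delta>'"
    using level_below[of "min \<delta> \<delta>'"] \<delta> by auto
  define \<rho> where "\<rho> = (1 / real CARD('s)) ^ n"
  have \<rho>: "0 < \<rho>" "\<rho> \<le> \<delta>" "\<rho> \<le> \<delta>'"
    using n alphabet_gt_1 by (auto simp: \<rho>_def)
  define W where "W = (\<lambda>x. restrict x {..<n}) ` F"
  define r where "r = inv_into F (\<lambda>x. restrict x {..<n})"
  have "finite W"
    by (rule finite_subset[OF _ finite_words[of n]]) (simp add: W_def image_subset_iff)
  have r: "r y \<in> F" "restrict (r y) {..<n} = y" if "y \<in> W" for y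
    using that inv_into_into[of y "\<lambda>x. restrict x {..<n}" F] f_inv_into_f[of y "\<lambda>x. restrict x {..<n}" F]
    unfolding W_def r_def by auto
  have inj: "inj_on r W"
    by (metis inj_onI r(2))
  have diam_le: "seqs.diam_powr s (cylinder n x) \<le> ennreal ((2 * \<rho>) powr s)" for x :: "nat \<Rightarrow> 's"
  proof (cases "s = 0")
    case False
    have "enn2real (seqs.ediam (cylinder n x)) \<le> \<rho>"
      using ediam_cylinder_le[of n x] \<rho> by (intro enn2real_leI) (auto simp: \<rho>_def)
    then have "enn2real (seqs.ediam (cylinder n x)) powr s \<le> (2 * \<rho>) powr s"
      using s \<rho> by (intro powr_mono2) auto
    then show ?thesis
      using False by (auto simp: seqs.diam_powr_def ennreal_leI)
  qed (use \<rho> in \<open>auto simp: seqs.diam_powr_def\<close>)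
  obtain h where h: "bij_betw h {0..<card W} W"
    using ex_bij_betw_nat_finite[OF \<open>finite W\<close>] by blast
  define U where "U i = (if i < card W then cylinder n (r (h i)) else {})" for i
  have "F \<subseteq> (\<Union>i. U i)"
  proof
    fix x
    assume "x \<in> F"
    then have W: "restrict x {..<n} \<in> W" by (simp add: W_def)
    then obtain i where i: "i < card W" "h i = restrict x {..<n}"
      using h by (metis atLeastLessThan_iff bij_betw_def imageE)
    have "restrict (r (h i)) {..<n} = restrict x {..<n}"
      using r(2)[OF W] i by simp
    then have "x \<in> cylinder n (r (h i))"
      unfolding cylinder_def by (auto simp: fun_eq_iff restrict_def split: if_splits)
    then show "x \<in> (\<Union>i. U i)"
      using i by (auto simp: U_def)
  qed
  moreover have "seqs.ediam (U i) \<le> ennreal \<delta>" for i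
  proof (cases "i < card W")
    case True
    have "seqs.ediam (U i) \<le> ennreal \<rho>"
      using True ediam_cylinder_le by (simp add: U_def \<rho>_def)
    also have "\<dots> \<le> ennreal \<delta>"
      using \<rho> by (intro ennreal_leI)
    finally show ?thesis .
  qed (simp add: U_def seqs.ediam_def)
  ultimately have "seqs.hausdorff_content \<delta> s F \<le> (\<Sum>i. seqs.diam_powr s (U i))"
    unfolding seqs.hausdorff_content_def by (intro INF_lower) auto
  also have "\<dots> = (\<Sum>i<card W. seqs.diam_powr s (U i))"
    by (rule suminf_finite) (auto simp: U_def seqs.diam_powr_def)
  also have "\<dots> \<le> (\<Sum>i<card W. ennreal ((2 * \<rho>) powr s))"
    by (intro sum_mono) (simp add: U_def diam_le)
  also have "\<dots> = (\<Sum>y\<in>W. ennreal ((2 * \<rho>) powr s))"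
    by simp
  also have "\<dots> = (\<Sum>p\<in>(\<lambda>y. (r y, \<rho>)) ` W. case p of (x, r) \<Rightarrow> ennreal ((2 * r) powr s))"
    by (subst sum.reindex) (use inj in \<open>auto simp: inj_on_def\<close>)
  also have "\<dots> = (\<Sum>\<^sub>\<infinity>(x, r)\<in>(\<lambda>y. (r y, \<rho>)) ` W. ennreal ((2 * r) powr s))"
    using \<open>finite W\<close> by simp
  also have "\<dots> \<le> (SUP B\<in>seqs.packings \<delta>' F. \<Sum>\<^sub>\<infinity>(x, r)\<in>B. ennreal ((2 * r) powr s))"
  proof (rule SUP_upper)
    have "disjnt (cylinder n (r y)) (cylinder n (r y'))" if "y \<in> W" "y' \<in> W" "r y \<noteq> r y'" for y y'
    proof -
      have "y \<noteq> y'" using that by auto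
      then have "restrict (r y) {..<n} \<noteq> restrict (r y') {..<n}"
        using r(2) that by simp
      then obtain k where "k < n" "r y k \<noteq> r y' k"
        by (auto simp: fun_eq_iff restrict_def split: if_splits)
      then show ?thesis
        by (auto simp: disjnt_def cylinder_def)
    qed
    then show "(\<lambda>y. (r y, \<rho>)) ` W \<in> seqs.packings \<delta>' F"
      using \<rho> r(1) \<open>finite W\<close> unfolding seqs.packings_def
      by (auto simp: pairwise_def \<rho>_def mcball_eq_cylinder countable_finite)
  qed
  finally show "seqs.hausdorff_content \<delta> s F \<le> \<dots>" .
qed

lemma hausdorff_content_countably_subadditive:
  fixes F :: "nat \<Rightarrow> (nat \<Rightarrow> 's) set"
  shows "seqs.hausdorff_content \<delta> s (\<Union>i. F i) \<le> (\<Sum>i. seqs.hausdorff_content \<delta> s (F i))"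
proof (rule ennreal_le_epsilon)
  fix e :: real
  assume e: "0 < e" and fin: "(\<Sum>i. seqs.hausdorff_content \<delta> s (F i)) < top"
  define \<epsilon> where "\<epsilon> i = e * (1 / 2) ^ Suc i" for i
  let ?cov = "\<lambda>E. {U :: nat \<Rightarrow> (nat \<Rightarrow> 's) set. E \<subseteq> (\<Union>i. U i) \<and> (\<forall>i. U i \<subseteq> UNIV \<and> seqs.ediam (U i) \<le> ennreal \<delta>)}"
  have "\<exists>U\<in>?cov (F i). (\<Sum>j. seqs.diam_powr s (U j)) \<le> seqs.hausdorff_content \<delta> s (F i) + ennreal (\<epsilon> i)" for i
  proof -
    have "seqs.hausdorff_content \<delta> s (F i) \<noteq> top"
      using ennreal_suminf_lessD[OF fin] by (simp add: less_top)
    then have "seqs.hausdorff_content \<delta> s (F i) < seqs.hausdorff_content \<delta> s (F i) + ennreal (\<epsilon> i)"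
      using e ennreal_add_left_cancel_less[of "seqs.hausdorff_content \<delta> s (F i)" 0 "ennreal (\<epsilon> i)"]
      by (simp add: \<epsilon>_def)
    then show ?thesis
      unfolding seqs.hausdorff_content_def[of \<delta> s "F i"] INF_less_iff by (auto intro: less_imp_le)
  qed
  then have "\<forall>i. \<exists>U. U \<in> ?cov (F i) \<and>
      (\<Sum>j. seqs.diam_powr s (U j)) \<le> seqs.hausdorff_content \<delta> s (F i) + ennreal (\<epsilon> i)"
    by blast
  from choice[OF this] obtain U where U: "\<And>i. U i \<in> ?cov (F i)"
      "\<And>i. (\<Sum>j. seqs.diam_powr s (U i j)) \<le> seqs.hausdorff_content \<delta> s (F i) + ennreal (\<epsilon> i)"
    by blast
  define V where "V n = (case prod_decode n of (i, j) \<Rightarrow> U i j)" for n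
  have V: "V (prod_encode (i, j)) = U i j" for i j by (simp add: V_def)
  have "V \<in> ?cov (\<Union>i. F i)"
  proof -
    have "x \<in> (\<Union>n. V n)" if "x \<in> F i" for x i
    proof -
      have "x \<in> (\<Union>j. U i j)" using U(1)[of i] that by blast
      then obtain j where "x \<in> U i j" by blast
      then show ?thesis by (auto simp flip: V)
    qed
    moreover have "seqs.ediam (V n) \<le> ennreal \<delta>" for n
      using U(1) by (auto simp: V_def split: prod.split)
    ultimately show ?thesis by auto
  qed
  then have "seqs.hausdorff_content \<delta> s (\<Union>i. F i) \<le> (\<Sum>n. seqs.diam_powr s (V n))"
    unfolding seqs.hausdorff_content_def by (rule INF_lower)
  also have "\<dots> = (\<Sum>i. \<Sum>j. seqs.diam_powr s (U i j))"
    using suminf_ennreal_2dimen[of "\<lambda>i. \<Sum>j. seqs.diam_powr s (U i j)" "\<lambda>(i, j). seqs.diam_powr s (U i j)"]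
    by (simp add: V_def o_def case_prod_beta)
  also have "\<dots> \<le> (\<Sum>i. seqs.hausdorff_content \<delta> s (F i) + ennreal (\<epsilon> i))"
    by (intro suminf_le U summableI)
  also have "\<dots> = (\<Sum>i. seqs.hausdorff_content \<delta> s (F i)) + (\<Sum>i. ennreal (\<epsilon> i))"
    by (intro suminf_add[symmetric] summableI)
  also have "(\<Sum>i. ennreal (\<epsilon> i)) = ennreal e"
  proof -
    have "\<epsilon> sums e"
      unfolding \<epsilon>_def[abs_def] using sums_mult[OF power_half_series, of e] by simp
    then show ?thesis
      by (rule suminf_ennreal_eq[rotated]) (use e in \<open>simp add: \<epsilon>_def\<close>)
  qed
  finally show "seqs.hausdorff_content \<delta> s (\<Union>i. F i) \<le> (\<Sum>i. seqs.hausdorff_content \<delta> s (F i)) + ennreal e" .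
qed

lemma hausdorff_measure_le_packing_measure:
  fixes E :: "(nat \<Rightarrow> 's) set"
  assumes s: "0 \<le> s"
  shows "seqs.hausdorff_measure s E \<le> seqs.packing_measure s E"
  unfolding seqs.hausdorff_measure_def seqs.packing_measure_def
proof (intro SUP_least INF_greatest)
  fix \<delta> :: real and F :: "nat \<Rightarrow> (nat \<Rightarrow> 's) set"
  assume \<delta>: "\<delta> \<in> {0<..}" and F: "F \<in> {F. E \<subseteq> (\<Union>i. F i) \<and> (\<forall>i. F i \<subseteq> UNIV)}"
  have "seqs.hausdorff_content \<delta> s E \<le> seqs.hausdorff_content \<delta> s (\<Union>i. F i)"
    unfolding seqs.hausdorff_content_def using F by (intro INF_superset_mono) auto
  also have "\<dots> \<le> (\<Sum>i. seqs.hausdorff_content \<delta> s (F i))"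
    by (rule hausdorff_content_countably_subadditive)
  also have "\<dots> \<le> (\<Sum>i. seqs.packing_premeasure s (F i))"
    using \<delta> by (intro suminf_le summableI hausdorff_content_le_packing_premeasure s) auto
  finally show "seqs.hausdorff_content \<delta> s E \<le> (\<Sum>i. seqs.packing_premeasure s (F i))" .
qed

lemma hausdorff_dim_le_packing_dim:
  fixes E :: "(nat \<Rightarrow> 's) set"
  shows "seqs.hausdorff_dim E \<le> seqs.packing_dim E"
proof -
  have "seqs.hausdorff_measure s E = 0" if "0 \<le> s" "seqs.packing_measure s E = 0" for s
    using hausdorff_measure_le_packing_measure[OF that(1), of E] that(2) by simp
  then show ?thesis
    unfolding seqs.hausdorff_dim_def seqs.packing_dim_def
    by (intro Inf_superset_mono image_mono) auto
qed

text \<open>Balls are cylinders, so a packing contains at most as many balls of level \<open>k\<close> as there are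
  words of length \<open>k\<close> in \<open>F\<close>. Growth of that number at a rate \<open>s' < s\<close> turns the packing sum
  into the tail of a geometric series.\<close>

lemma packing_premeasure_zero:
  fixes F :: "(nat \<Rightarrow> 's) set"
  assumes s: "0 \<le> s" "s' < s"
    and count: "\<forall>\<^sub>F n in sequentially.
      real (card ((\<lambda>x. restrict x {..<n}) ` F)) \<le> K * real CARD('s) powr (s' * real n)"
  shows "seqs.packing_premeasure s F = 0"
proof -
  define q where "q = real CARD('s)"
  have q: "1 < q" using alphabet_gt_1 by (simp add: q_def)
  define r where "r = q powr (s' - s)"
  have r: "0 < r" "r < 1"
    using q s by (auto simp: r_def powr_less_one)
  define C where "C = K * (2 * q) powr s / (1 - r)"
  obtain n1 where n1: "\<And>n. n1 \<le> n \<Longrightarrow>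
      real (card ((\<lambda>x. restrict x {..<n}) ` F)) \<le> K * q powr (s' * real n)"
    using count unfolding eventually_sequentially q_def by blast
  have bound: "seqs.packing_premeasure s F \<le> ennreal (C * r ^ n)" if n: "Suc n1 \<le> n" for n
  proof -
    let ?\<delta> = "(1 / q) ^ n"
    have "seqs.packing_premeasure s F \<le> (SUP B\<in>seqs.packings ?\<delta> F. \<Sum>\<^sub>\<infinity>(x, t)\<in>B. ennreal ((2 * t) powr s))"
      unfolding seqs.packing_premeasure_def by (rule INF_lower) (use q in simp)
    also have "\<dots> \<le> ennreal (C * r ^ n)"
    proof (intro SUP_least infsum_le_finite_sums)
      fix B A
      assume B: "B \<in> seqs.packings ?\<delta> F" and A: "finite A" "A \<subseteq> B"
      have ball: "fst p \<in> F" "0 < snd p" "snd p \<le> ?\<delta>" if "p \<in> A" for p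
        using B A(2) that unfolding seqs.packings_def by fastforce+
      have disj: "disjnt (seqs.mcball (fst p) (snd p)) (seqs.mcball (fst p') (snd p'))"
        if "p \<in> A" "p' \<in> A" "p \<noteq> p'" for p p'
        using B A(2) that unfolding seqs.packings_def pairwise_def by blast
      \<comment> \<open>the length of the cylinder that the ball is equal to\<close>
      define lev where "lev p = (LEAST k. (1 / q) ^ k \<le> snd p)" for p :: "(nat \<Rightarrow> 's) \<times> real"
      have lev: "(1 / q) ^ lev p \<le> snd p" if "p \<in> A" for p
        unfolding lev_def
        by (rule LeastI_ex) (use level_below[OF ball(2)[OF that]] in \<open>simp add: q_def\<close>)
      have lev_ge: "n \<le> lev p" if "p \<in> A" for p
      proof -
        have "(1 / q) ^ lev p \<le> (1 / q) ^ n"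
          using lev[OF that] ball(3)[OF that] by (rule order_trans)
        then show ?thesis
          using q by (subst (asm) power_decreasing_iff) auto
      qed
      have radius: "(2 * snd p) powr s \<le> (2 * q) powr s * q powr (- s * real (lev p))" if "p \<in> A" for p
      proof -
        obtain k where k: "lev p = Suc k"
          using lev_ge[OF \<open>p \<in> A\<close>] n by (cases "lev p") auto
        then have "\<not> (1 / q) ^ k \<le> snd p"
          unfolding lev_def by (metis lessI not_less_Least)
        then have "snd p \<le> q * (1 / q) ^ lev p"
          using q k by simp
        then have "(2 * snd p) powr s \<le> (2 * q * (1 / q) ^ lev p) powr s"
          using ball[OF that] s by (intro powr_mono2) auto
        also have "\<dots> = (2 * q) powr s * ((1 / q) ^ lev p) powr s"
          using q by (intro powr_mult)
        finally show ?thesis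
          by (simp add: q_def power_level_powr)
      qed
      \<comment> \<open>two balls of level \<open>k\<close> whose centres share \<open>k\<close> letters would intersect\<close>
      have level_card: "real (card {p\<in>A. lev p = k}) \<le> K * q powr (s' * real k)" if "k \<in> lev ` A" for k
      proof -
        have "card {p\<in>A. lev p = k} \<le> card ((\<lambda>x. restrict x {..<k}) ` F)"
        proof (rule card_inj_on_le)
          show "inj_on (\<lambda>p. restrict (fst p) {..<k}) {p\<in>A. lev p = k}"
          proof (rule inj_onI, rule ccontr)
            fix p p'
            assume p: "p \<in> {p\<in>A. lev p = k}" "p' \<in> {p\<in>A. lev p = k}"
              and eq: "restrict (fst p) {..<k} = restrict (fst p') {..<k}" and "p \<noteq> p'"
            have "fst p' \<in> cylinder k (fst p)"
              unfolding cylinder_def mem_Collect_eq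
            proof (intro allI impI)
              fix j assume "j < k"
              then show "fst p' j = fst p j" using fun_cong[OF eq, of j] by simp
            qed
            then have "seq_dist (fst p) (fst p') \<le> (1 / q) ^ k"
              by (simp add: q_def seq_dist_le_iff_cylinder)
            also have "\<dots> \<le> snd p"
              using lev[of p] p by simp
            finally have "fst p' \<in> seqs.mcball (fst p) (snd p)"
              by simp
            moreover have "fst p' \<in> seqs.mcball (fst p') (snd p')"
              using ball(2)[of p'] p by simp
            moreover have "disjnt (seqs.mcball (fst p) (snd p)) (seqs.mcball (fst p') (snd p'))"
              using disj p \<open>p \<noteq> p'\<close> by simp
            ultimately show False
              unfolding disjnt_def by blast
          qed
          show "(\<lambda>p. restrict (fst p) {..<k}) ` {p\<in>A. lev p = k} \<subseteq> (\<lambda>x. restrict x {..<k}) ` F"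
            using ball(1) by auto
          show "finite ((\<lambda>x. restrict x {..<k}) ` F)"
            by (rule finite_subset[OF _ finite_words[of k]]) (simp add: image_subset_iff)
        qed
        moreover have "n1 \<le> k" using that lev_ge n by fastforce
        ultimately show ?thesis
          using n1[of k] by linarith
      qed
      have "(\<Sum>p\<in>A. (2 * snd p) powr s) \<le> (\<Sum>p\<in>A. (2 * q) powr s * q powr (- s * real (lev p)))"
        by (intro sum_mono radius)
      also have "\<dots> = (\<Sum>k\<in>lev ` A. \<Sum>p\<in>{p\<in>A. lev p = k}. (2 * q) powr s * q powr (- s * real (lev p)))"
        by (rule sum.image_gen[OF A(1)])
      also have "\<dots> = (\<Sum>k\<in>lev ` A. real (card {p\<in>A. lev p = k}) * ((2 * q) powr s * q powr (- s * real k)))"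
        by (intro sum.cong refl) simp
      also have "\<dots> \<le> (\<Sum>k\<in>lev ` A. K * q powr (s' * real k) * ((2 * q) powr s * q powr (- s * real k)))"
        by (intro sum_mono mult_right_mono level_card) auto
      also have "\<dots> = (\<Sum>k\<in>lev ` A. K * (2 * q) powr s * r ^ k)"
      proof (intro sum.cong refl)
        fix k
        have "r ^ k = q powr ((s' - s) * real k)"
          using q r(1) by (simp add: r_def powr_powr[symmetric] powr_realpow)
        also have "\<dots> = q powr (s' * real k) * q powr (- s * real k)"
          by (simp add: powr_add[symmetric] algebra_simps)
        finally show "K * q powr (s' * real k) * ((2 * q) powr s * q powr (- s * real k)) = K * (2 * q) powr s * r ^ k"
          by simp
      qed
      also have "\<dots> = K * (2 * q) powr s * (\<Sum>k\<in>lev ` A. r ^ k)"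
        by (simp add: sum_distrib_left)
      also have "\<dots> \<le> K * (2 * q) powr s * (r ^ n / (1 - r))"
      proof (rule mult_left_mono)
        show "(\<Sum>k\<in>lev ` A. r ^ k) \<le> r ^ n / (1 - r)"
          using A(1) lev_ge r by (intro sum_power_tail_le) auto
        have "0 \<le> K * q powr (s' * real n1)"
          using n1[of n1] by (meson of_nat_0_le_iff order_trans order_refl)
        then show "0 \<le> K * (2 * q) powr s"
          using q by (simp add: zero_le_mult_iff)
      qed
      finally have "(\<Sum>p\<in>A. (2 * snd p) powr s) \<le> C * r ^ n"
        by (simp add: C_def)
      then have "ennreal (\<Sum>p\<in>A. (2 * snd p) powr s) \<le> ennreal (C * r ^ n)"
        by (rule ennreal_leI)
      then show "(\<Sum>(x, t)\<in>A. ennreal ((2 * t) powr s)) \<le> ennreal (C * r ^ n)"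
        by (simp add: sum_ennreal case_prod_beta)
    qed (auto intro: nonneg_summable_on_complete)
    finally show ?thesis .
  qed
  have "(\<lambda>n. C * r ^ n) \<longlonglongrightarrow> 0"
    using r by (intro tendsto_mult_right_zero LIMSEQ_realpow_zero) auto
  then have "(\<lambda>n. ennreal (C * r ^ n)) \<longlonglongrightarrow> ennreal 0"
    by (rule tendsto_ennrealI)
  then have "seqs.packing_premeasure s F \<le> ennreal 0"
    by (rule tendsto_lowerbound) (use bound in \<open>auto simp: eventually_sequentially\<close>)
  then show ?thesis by simp
qed

lemma packing_measure_zero:
  fixes F :: "nat \<Rightarrow> (nat \<Rightarrow> 's) set"
  assumes "E \<subseteq> (\<Union>i. F i)" "\<And>i. seqs.packing_premeasure s (F i) = 0"
  shows "seqs.packing_measure s E = 0"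
proof -
  have "seqs.packing_measure s E \<le> (\<Sum>i. seqs.packing_premeasure s (F i))"
    unfolding seqs.packing_measure_def by (rule INF_lower) (use assms in auto)
  then show ?thesis by (simp add: assms(2))
qed

end

section \<open>Counting words of the level set\<close>

context
  fixes g :: "'s::finite \<Rightarrow> 's \<Rightarrow> real" and w :: "nat \<Rightarrow> real" and \<psi> :: "real \<Rightarrow> real"
    and \<alpha> \<beta> :: real
  assumes pressure_limit:
      "\<And>b. (\<lambda>n. ln (partition_sum g (\<lambda>k. b * w k) n) / real n) \<longlonglongrightarrow> \<psi> b"
begin

text \<open>Each word of a non-deviating sequence has weight about \<open>exp (n * \<alpha> * \<beta>)\<close> in a partition sum
  of size about \<open>exp (n * \<psi> \<beta>)\<close>. The same \<open>k\<close> and \<open>s'\<close> serve all starting times \<open>m\<close>.\<close>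

lemma nondeviating_words_count:
  assumes q: "1 < q" and s: "\<psi> \<beta> - \<alpha> * \<beta> < s * ln q"
  shows "\<exists>k s' K. s' < s \<and> (\<forall>m. \<forall>\<^sub>F n in sequentially.
    real (card ((\<lambda>x. restrict x {..<n}) ` {x. \<forall>n\<ge>m. \<not> deviates g w \<alpha> (1 / real (Suc k)) n x}))
      \<le> K * q powr (s' * real n))"
proof -
  define \<eta> where "\<eta> = (s * ln q - (\<psi> \<beta> - \<alpha> * \<beta>)) / 3"
  have \<eta>: "0 < \<eta>" "\<psi> \<beta> = s * ln q - 3 * \<eta> + \<alpha> * \<beta>"
    using s by (simp add: \<eta>_def) (simp add: \<eta>_def field_simps)
  obtain k where k: "\<bar>\<beta>\<bar> * (1 / real (Suc k)) \<le> \<eta>"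
    using inverse_Suc_slack[OF \<eta>(1)] by blast
  define s' where "s' = s - \<eta> / ln q"
  have lnq: "0 < ln q" using q by simp
  have s': "s' < s" "s' * ln q = s * ln q - \<eta>"
    using \<eta> lnq by (simp_all add: s'_def field_simps)
  \<comment> \<open>energies over \<open>n\<close> edges count words of length \<open>n + 1\<close>\<close>
  define K where "K = q powr (- s')"
  define F where "F m = {x. \<forall>n\<ge>m. \<not> deviates g w \<alpha> (1 / real (Suc k)) n x}" for m
  have "\<forall>\<^sub>F n in sequentially. real (card ((\<lambda>x. restrict x {..<n}) ` F m)) \<le> K * q powr (s' * real n)" for m
  proof -
    define Z where "Z n = partition_sum g (\<lambda>k. \<beta> * w k) n" for n
    have Z: "0 < Z n" for n by (simp add: Z_def partition_sum_pos)
    have "\<forall>\<^sub>F n in sequentially. ln (Z n) / real n < \<psi> \<beta> + \<eta>"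
      unfolding Z_def by (rule order_tendstoD(2)[OF pressure_limit]) (use \<eta> in simp)
    then have "\<forall>\<^sub>F n in sequentially. real (card ((\<lambda>x. restrict x {..<Suc n}) ` F m)) \<le> K * q powr (s' * real (Suc n))"
      using eventually_ge_at_top[of "Suc m"]
    proof eventually_elim
      case (elim n)
      let ?W = "(\<lambda>x. restrict x {..<Suc n}) ` F m"
      have weight: "exp (real n * (\<alpha> * \<beta> - \<eta>)) \<le> exp (energy g (\<lambda>k. \<beta> * w k) n y)" if "y \<in> ?W" for y
      proof -
        from that obtain x where x: "x \<in> F m" "y = restrict x {..<Suc n}" by blast
        then have "\<not> deviates g w \<alpha> (1 / real (Suc k)) n x"
          using elim by (auto simp: F_def)
        then have "real n * (\<alpha> * \<beta> - \<eta>) \<le> \<beta> * energy g w n x"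
          using nondeviating_energy_bound[OF _ k, of g w \<alpha> n x] by (simp add: abs_le_iff algebra_simps)
        moreover have "energy g w n y = energy g w n x"
          unfolding x(2) by (rule energy_cong) simp
        ultimately show ?thesis by (simp add: energy_scale)
      qed
      have sub: "?W \<subseteq> words (Suc n)" by (simp add: image_subset_iff)
      have "real (card ?W) * exp (real n * (\<alpha> * \<beta> - \<eta>)) = (\<Sum>y\<in>?W. exp (real n * (\<alpha> * \<beta> - \<eta>)))"
        by simp
      also have "\<dots> \<le> (\<Sum>y\<in>?W. exp (energy g (\<lambda>k. \<beta> * w k) n y))"
        by (intro sum_mono weight)
      also have "\<dots> \<le> Z n"
        unfolding Z_def partition_sum_def using sub by (intro sum_mono2) auto
      also have "Z n = exp (ln (Z n))" using Z by simp
      also have "\<dots> \<le> exp (real n * (\<psi> \<beta> + \<eta>))"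
        using elim by (simp add: pos_divide_less_eq mult.commute less_imp_le)
      also have "\<dots> = exp (real n * (s * ln q - \<eta>)) * exp (real n * (\<alpha> * \<beta> - \<eta>))"
        unfolding \<eta>(2) by (simp add: algebra_simps flip: exp_add)
      finally have "real (card ?W) \<le> exp (real n * (s * ln q - \<eta>))"
        by simp
      also have "\<dots> = q powr (s' * real n)"
        using q by (simp add: powr_def s'(2)[symmetric] mult_ac)
      also have "\<dots> = K * q powr (s' * real (Suc n))"
        by (simp add: K_def powr_add[symmetric] algebra_simps)
      finally show ?case .
    qed
    then show ?thesis
      using eventually_sequentially_Suc[of "\<lambda>n. real (card ((\<lambda>x. restrict x {..<n}) ` F m)) \<le> K * q powr (s' * real n)"]
      by blast
  qed
  with s'(1) show ?thesis
    unfolding F_def by blast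
qed

text \<open>The partition sum dominates each of its terms. This makes the claimed dimension nonnegative as
  soon as the level set has a point.\<close>

lemma typical_mean_le_pressure:
  assumes x: "(\<lambda>n. energy g w n x / real n) \<longlonglongrightarrow> \<alpha>"
  shows "\<alpha> * \<beta> \<le> \<psi> \<beta>"
proof (rule LIMSEQ_le[OF _ pressure_limit[of \<beta>]])
  show "(\<lambda>n. energy g w n x / real n * \<beta>) \<longlonglongrightarrow> \<alpha> * \<beta>"
    by (intro tendsto_mult x tendsto_const)
  have "energy g w n x * \<beta> \<le> ln (partition_sum g (\<lambda>k. \<beta> * w k) n)" for n
  proof -
    have "exp (energy g (\<lambda>k. \<beta> * w k) n (restrict x {..<Suc n})) \<le> partition_sum g (\<lambda>k. \<beta> * w k) n"
      unfolding partition_sum_def by (rule member_le_sum) (simp_all only: restrict_in_words finite_words exp_ge_zero)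
    also have "energy g (\<lambda>k. \<beta> * w k) n (restrict x {..<Suc n}) = energy g (\<lambda>k. \<beta> * w k) n x"
      by (rule energy_cong) simp
    finally show ?thesis
      using partition_sum_pos[of g "\<lambda>k. \<beta> * w k" n] by (simp add: ln_ge_iff energy_scale mult.commute)
  qed
  then show "\<exists>N. \<forall>n\<ge>N. energy g w n x / real n * \<beta> \<le> ln (partition_sum g (\<lambda>k. \<beta> * w k) n) / real n"
    by (auto intro!: divide_right_mono)
qed

end

section \<open>The dimension of the level sets\<close>

lemma level_set_energy:
  assumes "\<And>x. f x = g (x 0) (x 1)"
  shows "level_set f w \<alpha> = {x. (\<lambda>n. energy g w n x / real n) \<longlonglongrightarrow> \<alpha>}"
  by (simp add: level_set_def energy_def assms seq_shift_funpow)

theorem corollary1p5: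
  fixes f :: "(nat \<Rightarrow> 's::finite) \<Rightarrow> real"
    and g :: "'s \<Rightarrow> 's \<Rightarrow> real"
    and w :: "nat \<Rightarrow> real"
    and V :: "real set"
    and \<nu> :: "(nat \<Rightarrow> real) measure"
    and N :: "real ^ 's ^ 's \<Rightarrow> real"
    and \<alpha> \<beta> :: real
  assumes "CARD('s) \<ge> 2"
    and "\<And>x. f x = g (x 0) (x 1)"
    and "finite V"
    and "\<And>k. w k \<in> V"
    and "borel_prob_on_seqs V \<nu>"
    and "shift_invariant \<nu>"
    and "shift_ergodic \<nu>"
    and "generic_for V \<nu> w"
    and "matrix_norm N"
    and "(pressure N g w has_real_derivative \<alpha>) (at \<beta>)"
  shows "Metric_space.hausdorff_dim UNIV seq_dist (level_set f w \<alpha>)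
           = Metric_space.packing_dim UNIV seq_dist (level_set f w \<alpha>) \<and>
         Metric_space.packing_dim UNIV seq_dist (level_set f w \<alpha>)
           = ereal ((pressure N g w \<beta> - \<alpha> * \<beta>) / ln (real CARD('s)))"
proof -
  interpret seqs: Metric_space "UNIV :: (nat \<Rightarrow> 's) set" seq_dist
    by (rule Metric_space_seq_dist)
  let ?q = "real CARD('s)"
  define \<psi> where "\<psi> = pressure N g w"
  define D where "D = (\<psi> \<beta> - \<alpha> * \<beta>) / ln ?q"
  define E where "E = level_set f w \<alpha>"
  have q: "1 < ?q" using assms(1) by linarith
  have lnq: "0 < ln ?q" using q by simp
  have limit: "(\<lambda>n. ln (partition_sum g (\<lambda>k. b * w k) n) / real n) \<longlonglongrightarrow> \<psi> b" for b
    unfolding \<psi>_def by (rule ln_partition_sum_tendsto_pressure[OF assms(3,4,8,9)])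
  have E: "E = {x. (\<lambda>n. energy g w n x / real n) \<longlonglongrightarrow> \<alpha>}"
    unfolding E_def by (rule level_set_energy) (rule assms(2))
  obtain B where "\<forall>k a b. \<bar>\<beta> * w k * g a b\<bar> \<le> B"
    using uniform_potential_bound[of V w \<beta> g] assms(3,4) by auto
  then have B: "\<bar>\<beta> * w k * g a b\<bar> \<le> B" for k a b by blast
  have deriv: "(\<psi> has_real_derivative \<alpha>) (at \<beta>)"
    using assms(10) by (simp add: \<psi>_def)
  have covers: "\<exists>n. heavy_covers ?q s n E" if "s < D" for s
    unfolding E
    by (rule cylinder_cover_bound[OF limit deriv B q])
      (use that lnq in \<open>simp add: D_def pos_less_divide_eq\<close>)
  \<comment> \<open>a negative exponent below \<open>D\<close> serves here, as no Hausdorff measure is involved\<close>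
  have "E \<noteq> {}"
  proof
    assume "E = {}"
    obtain n where "heavy_covers ?q (D - 1) n E"
      using covers[of "D - 1"] by auto
    then show False
      using \<open>E = {}\<close> unfolding heavy_covers_def by (auto dest!: spec[of _ "{}"])
  qed
  then obtain x where "x \<in> E" by blast
  then have "0 \<le> D"
    using typical_mean_le_pressure[OF limit, of x] lnq by (simp add: D_def E)
  have upper: "seqs.packing_dim E \<le> ereal D"
  proof (rule ereal_le_epsilon2)
    fix e :: real
    assume e: "0 < e"
    define s where "s = D + e"
    have "0 \<le> s" using \<open>0 \<le> D\<close> e by (simp add: s_def)
    have "D * ln ?q < s * ln ?q"
      using e lnq by (simp add: s_def)
    then have above: "\<psi> \<beta> - \<alpha> * \<beta> < s * ln ?q"
      using lnq by (simp add: D_def)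
    obtain k s' K where "s' < s" and count: "\<And>m. \<forall>\<^sub>F n in sequentially.
        real (card ((\<lambda>x. restrict x {..<n}) ` {x. \<forall>n\<ge>m. \<not> deviates g w \<alpha> (1 / real (Suc k)) n x}))
          \<le> K * ?q powr (s' * real n)"
      using nondeviating_words_count[OF limit q above] by blast
    have "seqs.packing_measure s E = 0"
    proof (rule packing_measure_zero[OF assms(1)])
      show "seqs.packing_premeasure s {x. \<forall>n\<ge>m. \<not> deviates g w \<alpha> (1 / real (Suc k)) n x} = 0" for m
        by (rule packing_premeasure_zero[OF assms(1) \<open>0 \<le> s\<close> \<open>s' < s\<close> count])
      show "E \<subseteq> (\<Union>m. {x. \<forall>n\<ge>m. \<not> deviates g w \<alpha> (1 / real (Suc k)) n x})"
      proof
        fix x assume "x \<in> E"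
        then have "\<exists>m. \<forall>n\<ge>m. \<not> deviates g w \<alpha> (1 / real (Suc k)) n x"
          using nondeviating_of_limit[of g w x \<alpha> "1 / real (Suc k)"] by (simp add: E)
        then show "x \<in> (\<Union>m. {x. \<forall>n\<ge>m. \<not> deviates g w \<alpha> (1 / real (Suc k)) n x})"
          by blast
      qed
    qed
    then show "seqs.packing_dim E \<le> ereal D + ereal e"
      unfolding seqs.packing_dim_def using \<open>0 \<le> s\<close> by (intro Inf_lower) (auto simp: s_def)
  qed
  have lower: "ereal D \<le> seqs.hausdorff_dim E"
    unfolding seqs.hausdorff_dim_def
  proof (rule Inf_greatest, clarify)
    fix s :: real
    assume s: "0 \<le> s" "seqs.hausdorff_measure s E = 0"
    show "ereal D \<le> ereal s"
    proof (rule ccontr)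
      assume "\<not> ereal D \<le> ereal s"
      then obtain n where "heavy_covers ?q s n E"
        using covers[of s] by auto
      then have "seqs.hausdorff_measure s E \<noteq> 0"
        by (rule hausdorff_measure_nonzero[OF assms(1) s(1)])
      with s(2) show False by simp
    qed
  qed
  have "seqs.hausdorff_dim E \<le> seqs.packing_dim E"
    by (rule hausdorff_dim_le_packing_dim[OF assms(1)])
  with upper lower show ?thesis
    unfolding E_def[symmetric] \<psi>_def[symmetric] D_def[symmetric] by auto
qed

end
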